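(* Let $R,R_0,r,P,\sigma$ be as in the context, and suppose that the balance equation $$\int_{1}^s \sigma(y)\,R(s/y)\,n(y)\,dy=\bigl(s-P(s)+s\,\sigma(s)R_0\bigr)\,n(s),\qquad s>1,$$ has a solution of the form $$n(1/x)=x^b(1-x)^d\,\frac{\rho(x)}{\sigma(x^{-1})},\qquad x\in(0,1),$$ with some $b>1$, $d>-1$ and a continuous, strictly positive, bounded function $\rho$ on $[0,1]$. Let $a_{\rm net}$ be the Pareto exponent of the net income $s$ (distributed with density proportional to $n(s)$ on $(1,\infty)$) and $a_{\rm gross}$ the Pareto exponent of the gross income $g=s\,(1+\sigma(s)R_0)$. Then: (1) if $\sigma$ is an $\ell$-demand, $a_{\rm gross}=1$ and $a_{\rm net}=2$; (2) if $\sigma$ is a $u$-demand, $a_{\rm gross}=a_{\rm net}=1$; (3) if $\sigma$ is an $s$-demand with limit $S_0$, $a_{\rm gross}=a_{\rm net}=1+\alpha$, where $\alpha>0$ is the unique solution of $$\frac{1}{R_0}\int_1^\infty s^\alpha R(s)\,ds=1+\frac{1}{R_0S_0}.$$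
   Context: The Pareto exponent of a positive random variable $X$ is $a=-\lim_{y\to\infty}\ln \Pr(X\ge y)/\ln y$. The price scale is normalized so that the minimal income is $1$; $n(s)$, $s\ge1$, is the density of agents with net income $s$. The pair-interaction intensity $R:[1,\infty)\to[0,\infty)$ is integrable with $R_0=\int_1^\infty R(y)\,dy>0$; the probability density $r=R/R_0$ on $[1,\infty)$ is bounded and continuous with $r(1)>0$. The welfare function $P:[1,\infty)\to[0,\infty)$ is continuous, nonincreasing, vanishes for all sufficiently large $s$, is differentiable at $1$, and satisfies the minimal-income relation $1-P(1)+\sigma(1)R_0=0$. The demand $\sigma:[1,\infty)\to(0,\infty)$ is smooth and monotone increasing with $\sigma(s)\le s$ and $\sigma(1)=1$, and belongs to one of the classes: - $\ell$-demand: $\sigma(s)=s$ for all $s\ge 1$; - $s$-demand: $\sigma(s)=s$ on some interval $[1,1/x_*]$, $x_*\in(0,1)$, and $\sigma(s)\to S_0<\infty$ as $s\to\infty$; - $u$-demand: $\sigma(s)=s$ on some interval $[1,1/x_*]$, $x_*\in(0,1)$, and as $s\to\infty$, $\sigma(s)\to\infty$ and $\sigma(st)/\sigma(s)\to1$ for every $t>0$. *)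

theory Defs
  imports "HOL-Probability.Probability"
begin

text \<open>
  The explicit condition that all tail probabilities are positive excludes the degenerate
  case in which the convention \<open>ln 0 = 0\<close> would assign exponent 0 to a bounded variable.
\<close>

definition has_pareto_exponent :: "'a measure \<Rightarrow> ('a \<Rightarrow> real) \<Rightarrow> real \<Rightarrow> bool" where
  "has_pareto_exponent M X a \<longleftrightarrow>
     prob_space M \<and> X \<in> borel_measurable M \<and> (AE \<omega> in M. X \<omega> > 0) \<and>
     (\<forall>y. measure M {\<omega> \<in> space M. X \<omega> \<ge> y} > 0) \<and>
     ((\<lambda>y. - (ln (measure M {\<omega> \<in> space M. X \<omega> \<ge> y}) / ln y)) \<longlongrightarrow> a) at_top"

text \<open>
  The underlying space is the open half line, so that the values at arguments \<open>\<le> 1\<close> of the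
  functions involved, which carry no information, are irrelevant also for measurability.
\<close>

definition net_income_distribution :: "(real \<Rightarrow> real) \<Rightarrow> real measure" where
  "net_income_distribution n =
     density (restrict_space lborel {1<..})
       (\<lambda>s. ennreal (n s / (LINT t:{1<..}|lborel. n t)))"

definition gross_income :: "(real \<Rightarrow> real) \<Rightarrow> real \<Rightarrow> real \<Rightarrow> real" where
  "gross_income \<sigma> R0 s = s * (1 + \<sigma> s * R0)"

text \<open>Derivatives of all orders on the closed half line, one-sided at 1.\<close>

definition smooth_from_1 :: "(real \<Rightarrow> real) \<Rightarrow> bool" where
  "smooth_from_1 f \<longleftrightarrow>
     (\<exists>D :: nat \<Rightarrow> real \<Rightarrow> real.
        (\<forall>s\<ge>1. D 0 s = f s) \<and>
        (\<forall>k. \<forall>s\<ge>1. (D k has_real_derivative D (Suc k) s) (at s within {1..})))"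

definition l_demand :: "(real \<Rightarrow> real) \<Rightarrow> bool" where
  "l_demand \<sigma> \<longleftrightarrow> (\<forall>s\<ge>1. \<sigma> s = s)"

definition s_demand :: "(real \<Rightarrow> real) \<Rightarrow> real \<Rightarrow> bool" where
  "s_demand \<sigma> S0 \<longleftrightarrow>
     (\<exists>x. 0 < x \<and> x < 1 \<and> (\<forall>s\<in>{1..1/x}. \<sigma> s = s)) \<and> (\<sigma> \<longlongrightarrow> S0) at_top"

definition u_demand :: "(real \<Rightarrow> real) \<Rightarrow> bool" where
  "u_demand \<sigma> \<longleftrightarrow>
     (\<exists>x. 0 < x \<and> x < 1 \<and> (\<forall>s\<in>{1..1/x}. \<sigma> s = s)) \<and>
     filterlim \<sigma> at_top at_top \<and>
     (\<forall>t>0. ((\<lambda>s. \<sigma> (s * t) / \<sigma> s) \<longlongrightarrow> 1) at_top)"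

definition demand_function :: "(real \<Rightarrow> real) \<Rightarrow> bool" where
  "demand_function \<sigma> \<longleftrightarrow>
     (\<forall>s\<ge>1. \<sigma> s > 0) \<and> smooth_from_1 \<sigma> \<and> mono_on {1..} \<sigma> \<and>
     (\<forall>s\<ge>1. \<sigma> s \<le> s) \<and> \<sigma> 1 = 1 \<and>
     (l_demand \<sigma> \<or> (\<exists>S0. s_demand \<sigma> S0) \<or> u_demand \<sigma>)"

text \<open>
  Integrability is part of the equation because the integral of a non-integrable function
  is 0 by convention.
\<close>

definition alpha_equation :: "(real \<Rightarrow> real) \<Rightarrow> real \<Rightarrow> real \<Rightarrow> real \<Rightarrow> bool" where
  "alpha_equation R R0 S0 \<alpha> \<longleftrightarrow>
     set_integrable lborel {1..} (\<lambda>s. s powr \<alpha> * R s) \<and>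
     1 / R0 * (LINT s:{1..}|lborel. s powr \<alpha> * R s) = 1 + 1 / (R0 * S0)"

end

theory Submission
  imports Defs "HOL-Real_Asymp.Real_Asymp"
begin

text \<open>
  Write \<open>n s = s powr (- b) * h s / \<sigma> s\<close> with \<open>h s = (1 - 1 / s) powr d * \<rho> (1 / s)\<close>, so that
  \<open>h\<close> tends to \<open>\<rho> 0 > 0\<close>. For large \<open>s\<close>, where \<open>P\<close> vanishes, the balance equation says that the
  multiplicative convolution of \<open>R\<close> with \<open>y powr (- b) * h y\<close> equals
  \<open>s powr (1 - b) * (1 / \<sigma> s + R0) * h s\<close>. Multiplying by \<open>s powr (b - 2)\<close>, integrating up to \<open>A\<close>
  and comparing the coefficients of \<open>ln A\<close> as \<open>A\<close> tends to infinity yields the moment identity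
  \<open>\<integral> t powr (b - 2) * R t dt = R0 + lim 1 / \<sigma>\<close>. Moments of \<open>R\<close> are strictly increasing in the
  exponent, so \<open>b = 2\<close> if \<open>\<sigma>\<close> is unbounded, and \<open>b = 2 + \<alpha>\<close> if \<open>\<sigma>\<close> tends to \<open>S0\<close>. If
  \<open>ln (\<sigma> s) / ln s\<close> tends to \<open>k\<close>, which is 1 for l-demand and 0 for the others, then the net
  exponent is \<open>b - 1 + k\<close> and the gross exponent is \<open>(b - 1 + k) / (1 + k)\<close>.
\<close>

section \<open>Multiplicative convolutions and the Mellin moment of their kernel\<close>

lemma nn_integral_inverse_Icc:
  fixes a c :: real
  assumes "0 < a" "a \<le> c"
  shows "(\<integral>\<^sup>+s. ennreal (1 / s) * indicator {a..c} s \<partial>lborel) = ennreal (ln c - ln a)"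
proof (rule nn_integral_FTC_Icc)
  show "(ln has_real_derivative 1 / x) (at x)" if "x \<in> {a..c}" for x
    using assms that by (auto intro!: derivative_eq_intros)
qed (use assms in auto)

text \<open>Tonelli, then the substitution \<open>s = y * t\<close> for fixed \<open>y\<close>. The
  Jacobian \<open>y\<close>, the weight factor \<open>y powr (b - 2)\<close> and
  \<open>y powr (- b)\<close> multiply to \<open>1 / y\<close>, which leaves a truncated moment of
  \<open>R\<close> for each \<open>y\<close>.\<close>

lemma nn_integral_multiplicative_convolution:
  fixes R h :: "real \<Rightarrow> real" and b a c :: real
  assumes [measurable]: "R \<in> borel_measurable borel" "h \<in> borel_measurable borel"
    and h_nonneg: "\<And>y. 0 \<le> h y" and h_zero: "\<And>y. y \<le> 1 \<Longrightarrow> h y = 0"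
    and R_nonneg: "\<And>t. 0 \<le> R t" and R_zero: "\<And>t. t < 1 \<Longrightarrow> R t = 0"
  shows "(\<integral>\<^sup>+s. ennreal (s powr (b - 2)) * indicator {a..c} s *
             (\<integral>\<^sup>+y. ennreal (R (s / y) * (y powr (- b) * h y)) \<partial>lborel) \<partial>lborel) =
         (\<integral>\<^sup>+y. ennreal (h y / y) *
             (\<integral>\<^sup>+t. ennreal (t powr (b - 2) * R t) * indicator {a..c} (t * y) \<partial>lborel) \<partial>lborel)"
    (is "?lhs = ?rhs")
proof -
  have "?lhs = (\<integral>\<^sup>+s. (\<integral>\<^sup>+y. ennreal (s powr (b - 2)) * indicator {a..c} s *
             ennreal (R (s / y) * (y powr (- b) * h y)) \<partial>lborel) \<partial>lborel)"
    by (simp add: nn_integral_cmult)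
  also have "\<dots> = (\<integral>\<^sup>+y. (\<integral>\<^sup>+s. ennreal (s powr (b - 2)) * indicator {a..c} s *
             ennreal (R (s / y) * (y powr (- b) * h y)) \<partial>lborel) \<partial>lborel)"
    by (rule lborel_pair.Fubini') measurable
  also have "\<dots> = ?rhs"
  proof (rule nn_integral_cong)
    fix y :: real
    show "(\<integral>\<^sup>+s. ennreal (s powr (b - 2)) * indicator {a..c} s *
             ennreal (R (s / y) * (y powr (- b) * h y)) \<partial>lborel) =
       ennreal (h y / y) *
             (\<integral>\<^sup>+t. ennreal (t powr (b - 2) * R t) * indicator {a..c} (t * y) \<partial>lborel)"
    \<comment> \<open>For \<open>y \<le> 1\<close> both sides vanish with \<open>h y\<close>;
      otherwise \<open>y\<close> is positive and can serve as a scaling factor.\<close>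
    proof (cases "y \<le> 1")
      case False
      then have y: "y > 0" by simp
      have "(\<integral>\<^sup>+s. ennreal (s powr (b - 2)) * indicator {a..c} s *
             ennreal (R (s / y) * (y powr (- b) * h y)) \<partial>lborel) =
          ennreal \<bar>y\<bar> * (\<integral>\<^sup>+t. ennreal ((0 + y * t) powr (b - 2)) * indicator {a..c} (0 + y * t) *
             ennreal (R ((0 + y * t) / y) * (y powr (- b) * h y)) \<partial>lborel)"
        using y by (intro nn_integral_real_affine) auto
      also have "\<dots> = (\<integral>\<^sup>+t. ennreal \<bar>y\<bar> * (ennreal ((0 + y * t) powr (b - 2)) * indicator {a..c} (0 + y * t) *
             ennreal (R ((0 + y * t) / y) * (y powr (- b) * h y))) \<partial>lborel)"
        by (intro nn_integral_cmult[symmetric]) measurable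
      also have "\<dots> = (\<integral>\<^sup>+t. ennreal (h y / y) *
             (ennreal (t powr (b - 2) * R t) * indicator {a..c} (t * y)) \<partial>lborel)"
      proof (rule nn_integral_cong)
        fix t :: real
        show "ennreal \<bar>y\<bar> * (ennreal ((0 + y * t) powr (b - 2)) * indicator {a..c} (0 + y * t) *
             ennreal (R ((0 + y * t) / y) * (y powr (- b) * h y))) =
           ennreal (h y / y) * (ennreal (t powr (b - 2) * R t) * indicator {a..c} (t * y))"
        proof (cases "t < 1")
          case False
          have "y * ((y * t) powr (b - 2) * (R t * (y powr (- b) * h y))) =
                h y / y * (t powr (b - 2) * R t)"
            using y False by (simp add: powr_mult powr_diff powr_minus field_simps power2_eq_square)
          then show ?thesis using y False h_nonneg R_nonneg
            by (auto simp: ennreal_mult[symmetric] indicator_def mult_ac split: if_splits)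
        qed (use R_zero y in simp)
      qed
      also have "\<dots> = ennreal (h y / y) *
             (\<integral>\<^sup>+t. ennreal (t powr (b - 2) * R t) * indicator {a..c} (t * y) \<partial>lborel)"
        by (intro nn_integral_cmult) measurable
      finally show ?thesis .
    qed (use h_zero in simp)
  qed
  finally show ?thesis .
qed

text \<open>
  Averaging the convolution against \<open>ds / s\<close> makes a possible singularity of \<open>h\<close> at 1
  negligible, so that no domination of the convolution integral is needed.
\<close>

lemma mellin_moment_of_convolution_limit:
  fixes R h L :: "real \<Rightarrow> real" and b c h0 :: real
  assumes [measurable]: "R \<in> borel_measurable borel" "h \<in> borel_measurable borel"
    and h_nonneg: "\<And>y. 0 \<le> h y" and h_zero: "\<And>y. y \<le> 1 \<Longrightarrow> h y = 0"
    and R_nonneg: "\<And>t. 0 \<le> R t" and R_zero: "\<And>t. t < 1 \<Longrightarrow> R t = 0"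
    and h_lim: "(h \<longlongrightarrow> h0) at_top" and h0: "0 < h0"
    and h_int: "\<And>s. (\<integral>\<^sup>+y. ennreal (h y / y) * indicator {1..s} y \<partial>lborel) < \<infinity>"
    and conv: "eventually (\<lambda>s. (\<integral>\<^sup>+y. ennreal (R (s / y) * (y powr (- b) * h y)) \<partial>lborel) =
                 ennreal (s powr (1 - b) * L s)) at_top"
    and L_lim: "(L \<longlongrightarrow> c) at_top" and c: "0 < c"
  shows "(\<integral>\<^sup>+t. ennreal (t powr (b - 2) * R t) \<partial>lborel) = ennreal (c / h0)"
proof -
  define K where "K = (\<lambda>t. ennreal (t powr (b - 2) * R t))"
  have [measurable]: "K \<in> borel_measurable borel" by (simp add: K_def)
  \<comment> \<open>Nothing is known yet about finiteness of the full moment \<open>Ginf\<close>, so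
    the upper bound is first proved for the truncations \<open>G u\<close>.\<close>
  define G where "G u = (\<integral>\<^sup>+t. K t * indicator {..u} t \<partial>lborel)" for u :: real
  define Ginf where "Ginf = (\<integral>\<^sup>+t. K t \<partial>lborel)"
  define F where "F s = (\<integral>\<^sup>+y. ennreal (R (s / y) * (y powr (- b) * h y)) \<partial>lborel)" for s
  define I where "I a A = (\<integral>\<^sup>+s. ennreal (s powr (b - 2)) * indicator {a..A} s * F s \<partial>lborel)" for a A
  have I_eq: "I a A = (\<integral>\<^sup>+y. ennreal (h y / y) * (\<integral>\<^sup>+t. K t * indicator {a..A} (t * y) \<partial>lborel) \<partial>lborel)" for a A
    unfolding I_def F_def K_def
    by (rule nn_integral_multiplicative_convolution) (use assms in auto)
  have sandwich: "\<exists>s1>1. \<forall>s\<ge>s1. F s = ennreal (s powr (1 - b) * L s) \<and>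
      \<bar>L s - c\<bar> \<le> e \<and> \<bar>h s - h0\<bar> \<le> e" if "e > 0" for e
  proof -
    have "eventually (\<lambda>s. dist (L s) c < e) at_top" "eventually (\<lambda>s. dist (h s) h0 < e) at_top"
      using L_lim h_lim that by (auto simp: tendsto_iff)
    with conv eventually_gt_at_top[of 1]
    have "eventually (\<lambda>s. 1 < s \<and> F s = ennreal (s powr (1 - b) * L s) \<and>
      \<bar>L s - c\<bar> \<le> e \<and> \<bar>h s - h0\<bar> \<le> e) at_top"
      by eventually_elim (auto simp: F_def dist_real_def)
    then show ?thesis
      unfolding eventually_at_top_linorder by (metis order.refl)
  qed
  \<comment> \<open>The exponents \<open>b - 2\<close> and \<open>1 - b\<close> add up to
    \<open>-1\<close>, so the weight turns the known value of the convolution into an average of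
    \<open>L\<close> against \<open>ds / s\<close>.\<close>
  have kernel: "ennreal (s powr (b - 2)) * ennreal (s powr (1 - b) * L s) = ennreal (1 / s) * ennreal (L s)"
    if "s > 0" "L s \<ge> 0" for s
  proof -
    have "s powr (b - 2) * (s powr (1 - b) * L s) = 1 / s * L s"
      using that by (simp add: mult.assoc[symmetric] powr_add[symmetric] powr_minus_divide)
    then show ?thesis using that by (simp add: ennreal_mult[symmetric])
  qed
  have I_upper: "I a A \<le> ennreal (c + e) * ennreal (ln A - ln a)"
    and I_lower: "ennreal (c - e) * ennreal (ln A - ln a) \<le> I a A"
    if "e > 0" "e < c" "a > 1" "a \<le> A" and
      s: "\<And>s. s \<ge> a \<Longrightarrow> F s = ennreal (s powr (1 - b) * L s) \<and> \<bar>L s - c\<bar> \<le> e" for e a A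
  proof -
    have I: "I a A = (\<integral>\<^sup>+s. ennreal (L s) * (ennreal (1 / s) * indicator {a..A} s) \<partial>lborel)"
      unfolding I_def
    proof (rule nn_integral_cong)
      fix s :: real
      show "ennreal (s powr (b - 2)) * indicator {a..A} s * F s =
         ennreal (L s) * (ennreal (1 / s) * indicator {a..A} s)"
      proof (cases "s \<in> {a..A}")
        case True
        then have "\<bar>L s - c\<bar> \<le> e" "s > 0" using s[of s] that(3) by auto
        moreover from this(1) have "L s \<ge> 0" using that(2) by linarith
        ultimately have "L s \<ge> 0" "s > 0" by auto
        with True s[of s] kernel[of s] show ?thesis by (simp add: mult_ac)
      qed simp
    qed
    have int: "(\<integral>\<^sup>+s. k * (ennreal (1 / s) * indicator {a..A} s) \<partial>lborel) = k * ennreal (ln A - ln a)" for k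
      using that by (subst nn_integral_cmult) (auto simp: nn_integral_inverse_Icc)
    have "I a A \<le> (\<integral>\<^sup>+s. ennreal (c + e) * (ennreal (1 / s) * indicator {a..A} s) \<partial>lborel)"
      unfolding I
    proof (intro nn_integral_mono)
      fix s show "ennreal (L s) * (ennreal (1 / s) * indicator {a..A} s) \<le>
          ennreal (c + e) * (ennreal (1 / s) * indicator {a..A} s)"
        using s[of s] by (cases "s \<in> {a..A}") (auto intro!: mult_right_mono ennreal_leI)
    qed
    then show "I a A \<le> ennreal (c + e) * ennreal (ln A - ln a)" by (simp add: int)
    have "(\<integral>\<^sup>+s. ennreal (c - e) * (ennreal (1 / s) * indicator {a..A} s) \<partial>lborel) \<le> I a A"
      unfolding I
    proof (intro nn_integral_mono)
      fix s show "ennreal (c - e) * (ennreal (1 / s) * indicator {a..A} s) \<le>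
          ennreal (L s) * (ennreal (1 / s) * indicator {a..A} s)"
        using s[of s] by (cases "s \<in> {a..A}") (auto intro!: mult_right_mono ennreal_leI)
    qed
    then show "ennreal (c - e) * ennreal (ln A - ln a) \<le> I a A" by (simp add: int)
  qed
  \<comment> \<open>Comparison of the coefficients of \<open>ln A\<close>: after division by
    \<open>ln A\<close> the constants \<open>p\<close> and \<open>q\<close> disappear as
    \<open>A\<close> tends to infinity.\<close>
  have log_average: "x \<le> y" if "eventually (\<lambda>A. x * (ln A - p) \<le> y * ln A + q) at_top" for x y p q :: real
  proof (rule tendsto_le[OF _ _ _ that[THEN eventually_conj, OF eventually_gt_at_top[of 1], THEN eventually_mono]])
    show "((\<lambda>A. y + q / ln A) \<longlongrightarrow> y) at_top" "((\<lambda>A. x - x * p / ln A) \<longlongrightarrow> x) at_top"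
      by real_asymp+
    show "x - x * p / ln A \<le> y + q / ln A"
      if "x * (ln A - p) \<le> y * ln A + q \<and> 1 < A" for A :: real
    proof -
      have "x - x * p / ln A = x * (ln A - p) / ln A" "y + q / ln A = (y * ln A + q) / ln A"
        using that by (simp_all add: field_simps)
      then show ?thesis using that by (simp add: divide_right_mono)
    qed
  qed auto
  have G_bound: "\<exists>g\<ge>0. G u = ennreal g \<and> (h0 - e) * g \<le> c + e"
    if e: "0 < e" "e < c" "e < h0" and u: "u \<ge> 1" for e u
  proof -
    obtain a where a: "a > 1" and
      s: "\<And>s. s \<ge> a \<Longrightarrow> F s = ennreal (s powr (1 - b) * L s) \<and> \<bar>L s - c\<bar> \<le> e \<and> \<bar>h s - h0\<bar> \<le> e"
      using sandwich[OF e(1)] by blast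
    \<comment> \<open>For \<open>y\<close> in \<open>{a..A / u}\<close> every \<open>t\<close> in
      \<open>{1..u}\<close> satisfies \<open>a \<le> t * y \<le> A\<close>, so the inner integral
      contains all of \<open>G u\<close>, while \<open>h y \<ge> h0 - e\<close>. Ending the range at
      \<open>A / u\<close> instead of \<open>A\<close> shortens its logarithmic length only by the
      constant \<open>ln u\<close>.\<close>
    have le: "ennreal (h0 - e) * ennreal (ln A - ln u - ln a) * G u \<le> ennreal (c + e) * ennreal (ln A - ln a)"
      if A: "A \<ge> a * u" for A
    proof -
      have "a \<le> A / u" and Apos: "A > 0" and aA: "a \<le> A"
        using A a u by (auto simp: field_simps intro: order.trans[OF _ A] less_le_trans[OF _ A])
      then have "ennreal (h0 - e) * ennreal (ln A - ln u - ln a) * G u =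
        (\<integral>\<^sup>+y. ennreal (h0 - e) * G u * (ennreal (1 / y) * indicator {a..A / u} y) \<partial>lborel)"
        using a u by (simp add: nn_integral_cmult nn_integral_inverse_Icc ln_div mult_ac)
      also have "\<dots> \<le> I a A"
        unfolding I_eq
      proof (rule nn_integral_mono)
        fix y :: real
        show "ennreal (h0 - e) * G u * (ennreal (1 / y) * indicator {a..A / u} y)
          \<le> ennreal (h y / y) * (\<integral>\<^sup>+t. K t * indicator {a..A} (t * y) \<partial>lborel)"
        proof (cases "y \<in> {a..A / u}")
          case True
          then have y: "y > 1" "h0 - e \<le> h y" "y * u \<le> A" "a \<le> y"
            using a s[of y] u by (auto simp: field_simps)
          have "G u \<le> (\<integral>\<^sup>+t. K t * indicator {a..A} (t * y) \<partial>lborel)"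
            unfolding G_def
          proof (rule nn_integral_mono)
            fix t :: real
            show "K t * indicator {..u} t \<le> K t * indicator {a..A} (t * y)"
            proof (cases "1 \<le> t \<and> t \<le> u")
              case True
              then have "1 * y \<le> t * y" "t * y \<le> u * y" using y by (auto intro!: mult_right_mono)
              then have "a \<le> t * y" "t * y \<le> A"
                using y by (linarith, metis mult.commute order.trans)
              then have "t * y \<in> {a..A}" by simp
              then show ?thesis by (simp add: indicator_def)
            next
              case False
              then show ?thesis using R_zero[of t] by (auto simp: K_def indicator_def)
            qed
          qed
          moreover have "ennreal (h0 - e) * ennreal (1 / y) \<le> ennreal (h y / y)"
            using y e by (auto simp: ennreal_mult[symmetric] divide_simps intro!: ennreal_leI)
          ultimately have "ennreal (h0 - e) * ennreal (1 / y) * G u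
              \<le> ennreal (h y / y) * (\<integral>\<^sup>+t. K t * indicator {a..A} (t * y) \<partial>lborel)"
            by (intro mult_mono) auto
          with True show ?thesis by (simp add: mult_ac)
        qed simp
      qed
      also have "\<dots> \<le> ennreal (c + e) * ennreal (ln A - ln a)"
        using e a aA s by (intro I_upper) auto
      finally show ?thesis .
    qed
    \<comment> \<open>An infinite \<open>G u\<close> contradicts \<open>le\<close> as soon as the
      logarithmic length on its left side is positive; for \<open>A = 2 * a * u\<close> that length
      is \<open>ln 2\<close>.\<close>
    have "G u \<noteq> \<top>"
    proof
      assume top: "G u = \<top>"
      define A where "A = 2 * a * u"
      have "A \<ge> a * u" "ln A - ln u - ln a > 0"
        using a u by (auto simp: A_def ln_mult)
      with le[of A] top e show False
        by (auto simp: ennreal_mult_top ennreal_mult[symmetric] ennreal_mult_eq_top_iff top_unique)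
    qed
    then obtain g where g: "G u = ennreal g" "g \<ge> 0" by (cases "G u") auto
    have "(h0 - e) * g \<le> c + e"
    proof (rule log_average)
      show "eventually (\<lambda>A. (h0 - e) * g * (ln A - (ln u + ln a)) \<le> (c + e) * ln A + (- (c + e) * ln a)) at_top"
        using eventually_ge_at_top[of "a * u"]
      proof eventually_elim
        case (elim A)
        have "a * 1 \<le> a * u" using a u by (intro mult_left_mono) auto
        then have "a \<le> A" "0 < a * u" using elim a by linarith+
        then have "ln (a * u) \<le> ln A" "ln a \<le> ln A" using elim a by (auto intro!: ln_mono)
        then have *: "0 \<le> ln A - ln u - ln a" "0 \<le> ln A - ln a" using a u by (auto simp: ln_mult)
        have "ennreal ((h0 - e) * (ln A - ln u - ln a) * g) \<le> ennreal ((c + e) * (ln A - ln a))"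
          using le[OF elim] * e g by (simp add: ennreal_mult)
        then have "(h0 - e) * (ln A - ln u - ln a) * g \<le> (c + e) * (ln A - ln a)"
          using * e c by (subst (asm) ennreal_le_iff) auto
        then show ?case by (simp add: algebra_simps)
      qed
    qed
    with g show ?thesis by blast
  qed
  have e_to_0: "x \<le> y" if "\<And>e. 0 < e \<Longrightarrow> e < c \<Longrightarrow> e < h0 \<Longrightarrow> f e \<le> k e"
    "(f \<longlongrightarrow> x) (at_right 0)" "(k \<longlongrightarrow> y) (at_right 0)" for f k :: "real \<Rightarrow> real" and x y
  proof (rule tendsto_le[OF _ that(3,2)])
    have "eventually (\<lambda>e. e \<in> {0<..<min c h0}) (at_right 0)"
      using c h0 by (intro eventually_at_right_real) auto
    then show "eventually (\<lambda>e. f e \<le> k e) (at_right 0)"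
      by eventually_elim (use that(1) in auto)
  qed auto
  have G_le: "G u \<le> ennreal (c / h0)" if u: "u \<ge> 1" for u
  proof -
    \<comment> \<open>This \<open>e\<close> only serves to obtain the real value \<open>g\<close> of
      \<open>G u\<close>; the bound on \<open>g\<close> then uses all small
      \<open>e\<close>.\<close>
    define e where "e = min c h0 / 2"
    have "0 < e" "e < c" "e < h0" using c h0 by (auto simp: e_def min_def)
    then obtain g where g: "G u = ennreal g" "g \<ge> 0" using G_bound u by metis
    have "h0 * g \<le> c"
    proof (rule e_to_0)
      show "(h0 - e) * g \<le> c + e" if "0 < e" "e < c" "e < h0" for e
        using G_bound[OF that u] g by auto
      show "((\<lambda>e. (h0 - e) * g) \<longlongrightarrow> h0 * g) (at_right 0)" "((\<lambda>e. c + e) \<longlongrightarrow> c) (at_right 0)"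
        by (auto intro!: tendsto_eq_intros)
    qed
    then show ?thesis using g h0 by (auto intro!: ennreal_leI simp: field_simps)
  qed
  \<comment> \<open>Monotone convergence over the truncations. Cutting at \<open>Suc i\<close>
    instead of \<open>i\<close> keeps the cut-off at least 1, as \<open>G_le\<close>
    requires.\<close>
  have "Ginf = (\<integral>\<^sup>+t. (SUP i. K t * indicator {..real (Suc i)} t) \<partial>lborel)"
    unfolding Ginf_def
  proof (rule nn_integral_cong)
    fix t :: real
    show "K t = (SUP i. K t * indicator {..real (Suc i)} t)"
    proof (rule antisym)
      obtain i where "t \<le> real (Suc i)" by (meson real_nat_ceiling_ge le_SucI of_nat_le_iff order.trans)
      then have "K t = K t * indicator {..real (Suc i)} t" by simp
      also have "\<dots> \<le> (SUP i. K t * indicator {..real (Suc i)} t)" by (rule SUP_upper) simp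
      finally show "K t \<le> (SUP i. K t * indicator {..real (Suc i)} t)" .
      show "(SUP i. K t * indicator {..real (Suc i)} t) \<le> K t"
        by (rule SUP_least) (auto simp: indicator_def)
    qed
  qed
  also have "\<dots> = (SUP i. G (real (Suc i)))"
    unfolding G_def
    by (rule nn_integral_monotone_convergence_SUP) (auto simp: incseq_def le_fun_def indicator_def)
  also have "\<dots> \<le> ennreal (c / h0)" by (rule SUP_least) (auto intro!: G_le)
  finally have Ginf_le: "Ginf \<le> ennreal (c / h0)" .
  then have "Ginf \<noteq> \<top>" by (auto simp: top_unique)
  then obtain g where g: "Ginf = ennreal g" "g \<ge> 0" by (cases Ginf) auto
  have g_bound: "c - e \<le> g * (h0 + e)" if e: "0 < e" "e < c" for e
  proof -
    obtain a where a: "a > 1" and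
      s: "\<And>s. s \<ge> a \<Longrightarrow> F s = ennreal (s powr (1 - b) * L s) \<and> \<bar>L s - c\<bar> \<le> e \<and> \<bar>h s - h0\<bar> \<le> e"
      using sandwich[OF e(1)] by blast
    have "(\<integral>\<^sup>+y. ennreal (h y / y) * indicator {1..a} y \<partial>lborel) \<noteq> \<top>" using h_int[of a] by auto
    then obtain H where H: "(\<integral>\<^sup>+y. ennreal (h y / y) * indicator {1..a} y \<partial>lborel) = ennreal H" "H \<ge> 0"
      by (cases "(\<integral>\<^sup>+y. ennreal (h y / y) * indicator {1..a} y \<partial>lborel)") auto
    \<comment> \<open>Reverse estimate, with the inner integral bounded by \<open>Ginf\<close>.
      Values \<open>y < a\<close>, near a possible singularity of \<open>h\<close>, contribute at
      most the constant \<open>Ginf * H\<close>; on \<open>{a..A}\<close> one has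
      \<open>h y \<le> h0 + e\<close>; and \<open>y > A\<close> contributes nothing, because
      \<open>t \<ge> 1\<close> forces \<open>t * y > A\<close>.\<close>
    have le: "ennreal (c - e) * ennreal (ln A - ln a) \<le> Ginf * (ennreal H + ennreal (h0 + e) * ennreal (ln A - ln a))"
      if A: "A \<ge> a" for A
    proof -
      have "ennreal (c - e) * ennreal (ln A - ln a) \<le> I a A"
        using e a A s by (intro I_lower) auto
      also have "\<dots> \<le> (\<integral>\<^sup>+y. Ginf * (ennreal (h y / y) * indicator {1..a} y +
           ennreal (h0 + e) * (ennreal (1 / y) * indicator {a..A} y)) \<partial>lborel)"
        unfolding I_eq
      proof (rule nn_integral_mono)
        fix y :: real
        consider "y \<le> 1" | "1 < y" "y < a" | "a \<le> y" "y \<le> A" | "A < y" "1 < y" by linarith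
        then show "ennreal (h y / y) * (\<integral>\<^sup>+t. K t * indicator {a..A} (t * y) \<partial>lborel) \<le>
           Ginf * (ennreal (h y / y) * indicator {1..a} y +
           ennreal (h0 + e) * (ennreal (1 / y) * indicator {a..A} y))"
        proof cases
          case 4
          have "K t * indicator {a..A} (t * y) = 0" for t
          proof (cases "t < 1")
            case True then show ?thesis by (simp add: K_def R_zero)
          next
            case False
            then have "1 * y \<le> t * y" using 4 by (intro mult_right_mono) auto
            then have "A < t * y" using 4 by linarith
            then show ?thesis by (simp add: indicator_def)
          qed
          then have "(\<integral>\<^sup>+t. K t * indicator {a..A} (t * y) \<partial>lborel) = 0"
            by (simp only: nn_integral_const mult_zero_left)
          then show ?thesis by simp
        next
          case 1 then show ?thesis by (simp add: h_zero)
        next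
          case 2
          have "(\<integral>\<^sup>+t. K t * indicator {a..A} (t * y) \<partial>lborel) \<le> Ginf"
            unfolding Ginf_def by (rule nn_integral_mono) (auto simp: indicator_def)
          then have "ennreal (h y / y) * (\<integral>\<^sup>+t. K t * indicator {a..A} (t * y) \<partial>lborel) \<le> ennreal (h y / y) * Ginf"
            by (intro mult_left_mono) auto
          with 2 show ?thesis by (simp add: mult_ac)
        next
          case 3
          have "(\<integral>\<^sup>+t. K t * indicator {a..A} (t * y) \<partial>lborel) \<le> Ginf"
            unfolding Ginf_def by (rule nn_integral_mono) (auto simp: indicator_def)
          moreover have "ennreal (h y / y) \<le> ennreal (h0 + e) * ennreal (1 / y)"
            using s[of y] 3 a e h0
            by (auto simp: ennreal_mult[symmetric] divide_simps simp del: ennreal_plus intro!: ennreal_leI)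
          ultimately have "ennreal (h y / y) * (\<integral>\<^sup>+t. K t * indicator {a..A} (t * y) \<partial>lborel) \<le>
              ennreal (h0 + e) * ennreal (1 / y) * Ginf"
            by (intro mult_mono) auto
          also have "\<dots> \<le> Ginf * (ennreal (h y / y) * indicator {1..a} y +
           ennreal (h0 + e) * (ennreal (1 / y) * indicator {a..A} y))"
            using 3 by (simp add: distrib_left mult_ac)
          finally show ?thesis .
        qed
      qed
      also have "\<dots> = Ginf * (ennreal H + ennreal (h0 + e) * ennreal (ln A - ln a))"
        using a A by (simp add: nn_integral_cmult nn_integral_add nn_integral_inverse_Icc H)
      finally show ?thesis .
    qed
    show ?thesis
    proof (rule log_average)
      show "eventually (\<lambda>A. (c - e) * (ln A - ln a) \<le> g * (h0 + e) * ln A + (g * H - g * (h0 + e) * ln a)) at_top"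
        using eventually_ge_at_top[of a]
      proof eventually_elim
        case (elim A)
        then have *: "0 \<le> ln A - ln a" using a by (auto intro!: ln_mono)
        have "ennreal ((c - e) * (ln A - ln a)) \<le> ennreal (g * (H + (h0 + e) * (ln A - ln a)))"
          using le[OF elim] * e g H h0
          by (simp add: ennreal_mult[symmetric] ennreal_plus[symmetric] del: ennreal_plus)
        then have "(c - e) * (ln A - ln a) \<le> g * (H + (h0 + e) * (ln A - ln a))"
          using * e c g H h0 by (subst (asm) ennreal_le_iff) auto
        then show ?case by (simp add: algebra_simps)
      qed
    qed
  qed
  have "c \<le> g * h0"
  proof (rule e_to_0)
    show "c - e \<le> g * (h0 + e)" if "0 < e" "e < c" "e < h0" for e
      using g_bound that by auto
    show "((\<lambda>e. g * (h0 + e)) \<longlongrightarrow> g * h0) (at_right 0)" "((\<lambda>e. c - e) \<longlongrightarrow> c) (at_right 0)"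
      by (auto intro!: tendsto_eq_intros)
  qed
  moreover have "g \<le> c / h0" using Ginf_le g c h0 by simp
  ultimately have "g = c / h0" using h0 by (simp add: field_simps)
  with g show ?thesis by (simp add: Ginf_def K_def)
qed

section \<open>Monotone moments, integrability at 1, and slow variation\<close>

text \<open>Powers with base at least 1 increase in the exponent, so the difference of the
  integrands is nonnegative. It is positive immediately to the right of 1 because \<open>R\<close>
  is continuous and \<open>R 1 > 0\<close>, hence its integral cannot vanish.\<close>

lemma set_integral_powr_strict_mono:
  fixes R :: "real \<Rightarrow> real"
  assumes R_nonneg: "\<And>t. t \<ge> 1 \<Longrightarrow> R t \<ge> 0" and R_cont: "continuous_on {1..} R" and R1: "R 1 > 0"
    and int_p: "set_integrable lborel {1..} (\<lambda>t. t powr p * R t)"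
    and int_q: "set_integrable lborel {1..} (\<lambda>t. t powr q * R t)"
    and "p < q"
  shows "(LINT t:{1..}|lborel. t powr p * R t) < (LINT t:{1..}|lborel. t powr q * R t)"
proof -
  define f where "f t = indicator {1..} t *\<^sub>R (t powr q * R t) - indicator {1..} t *\<^sub>R (t powr p * R t)" for t
  have int: "integrable lborel f"
    using int_p int_q unfolding f_def set_integrable_def by (rule Bochner_Integration.integrable_diff[rotated])
  have nonneg: "f t \<ge> 0" for t
    using R_nonneg[of t] \<open>p < q\<close> by (auto simp: f_def indicator_def intro!: mult_right_mono powr_mono)
  have "integral\<^sup>L lborel f \<noteq> 0"
  proof
    assume "integral\<^sup>L lborel f = 0"
    then have "AE t in lborel. f t = 0"
      using integral_nonneg_eq_0_iff_AE[OF int] nonneg by auto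
    \<comment> \<open>The tolerance \<open>R 1\<close> in the continuity of \<open>R\<close> at 1
      yields \<open>R t > 0\<close> near 1. The interval used below omits 1 itself, where both
      powers equal 1.\<close>
    obtain \<delta> where \<delta>: "\<delta> > 0" "\<And>t. t \<ge> 1 \<Longrightarrow> dist t 1 < \<delta> \<Longrightarrow> dist (R t) (R 1) < R 1"
      using R_cont R1 unfolding continuous_on_iff by (metis atLeast_iff order.refl)
    have pos: "f t > 0" if "t \<in> {1<..<1 + \<delta>}" for t
    proof -
      have "R t > 0" using \<delta>(2)[of t] that by (auto simp: dist_real_def)
      moreover have "t powr p < t powr q" using that \<open>p < q\<close> by (intro powr_less_mono) auto
      ultimately show ?thesis using that by (simp add: f_def)
    qed
    have "AE t in lborel. t \<notin> {1<..<1 + \<delta>}"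
      using \<open>AE t in lborel. f t = 0\<close> by eventually_elim (use pos in force)
    then have "emeasure lborel {1<..<1 + \<delta>} = 0"
      by (subst (asm) AE_iff_measurable[where N = "{1<..<1 + \<delta>}"]) auto
    then show False using \<delta>(1) by simp
  qed
  then have "integral\<^sup>L lborel f > 0"
    using Bochner_Integration.integral_nonneg[of lborel f] nonneg by (simp add: less_le)
  moreover have "integral\<^sup>L lborel f =
      (LINT t:{1..}|lborel. t powr q * R t) - (LINT t:{1..}|lborel. t powr p * R t)"
    using int_p int_q unfolding f_def set_integrable_def set_lebesgue_integral_def
    by (rule Bochner_Integration.integral_diff[rotated])
  ultimately show ?thesis by simp
qed

text \<open>The factor \<open>s powr (-2)\<close> is the derivative of \<open>1 - 1 / s\<close>, so
  there is an explicit antiderivative, which vanishes at 1 because \<open>d + 1 > 0\<close>. This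
  function dominates \<open>n\<close>, and on bounded ranges also \<open>h y / y\<close>, up to
  constants.\<close>

lemma set_integrable_beta_at_1:
  fixes d :: real
  assumes "d > -1"
  shows "set_integrable lborel {1<..} (\<lambda>s. (1 - 1 / s) powr d * s powr (-2))"
proof -
  have "set_integrable lborel (einterval 1 \<infinity>) (\<lambda>s. (1 - 1 / s) powr d * s powr (-2))"
  proof (rule interval_integral_FTC_nonneg(1)[where F = "\<lambda>s. (1 - 1 / s) powr (d + 1) / (d + 1)"])
    show "DERIV (\<lambda>s. (1 - 1 / s) powr (d + 1) / (d + 1)) x :> (1 - 1 / x) powr d * x powr (-2)"
      if "1 < ereal x" for x
    proof -
      have x: "x > 1" using that by (simp add: one_ereal_def)
      have "((\<lambda>s. (1 - 1 / s) powr (d + 1)) has_real_derivative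
              (d + 1) * (1 - 1 / x) powr (d + 1 - of_nat 1) * (1 / x\<^sup>2)) (at x)"
        using x by (intro DERIV_fun_powr) (auto intro!: derivative_eq_intros simp: power2_eq_square)
      from DERIV_cdivide[OF this, of "d + 1"] show ?thesis
        using x assms by (simp add: powr_minus_divide)
    qed
    show "isCont (\<lambda>s. (1 - 1 / s) powr d * s powr (-2)) x" if "1 < ereal x" for x
      using that by (auto intro!: continuous_intros simp: one_ereal_def)
    have "((\<lambda>s. (1 - 1 / s) powr (d + 1) / (d + 1)) \<longlongrightarrow> 0) (at_right 1)"
    proof -
      have "((\<lambda>s::real. (1 - 1 / s) powr (d + 1)) \<longlongrightarrow> 0) (at_right 1)"
      proof (rule tendsto_zero_powrI)
        show "((\<lambda>s::real. 1 - 1 / s) \<longlongrightarrow> 0) (at_right 1)" by (auto intro!: tendsto_eq_intros)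
        show "((\<lambda>s. d + 1) \<longlongrightarrow> d + 1) (at_right (1::real))" by simp
        show "\<forall>\<^sub>F s in at_right (1::real). 0 \<le> 1 - 1 / s"
          using eventually_at_right_less[of "1::real"] by eventually_elim auto
      qed (use assms in auto)
      from tendsto_divide[OF this tendsto_const[of "d + 1"]] show ?thesis using assms by simp
    qed
    then show "(((\<lambda>s. (1 - 1 / s) powr (d + 1) / (d + 1)) \<circ> real_of_ereal) \<longlongrightarrow> 0) (at_right 1)"
      by (simp add: one_ereal_def ereal_tendsto_simps)
    have "((\<lambda>s::real. (1 - 1 / s) powr (d + 1) / (d + 1)) \<longlongrightarrow> (1 - 0) powr (d + 1) / (d + 1)) at_top"
      using assms by (intro tendsto_intros) (auto intro!: tendsto_divide_0[OF tendsto_const] filterlim_at_top_imp_at_infinity filterlim_ident)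
    then show "(((\<lambda>s. (1 - 1 / s) powr (d + 1) / (d + 1)) \<circ> real_of_ereal) \<longlongrightarrow> (1 - 0) powr (d + 1) / (d + 1)) (at_left \<infinity>)"
      by (simp add: ereal_tendsto_simps)
  qed auto
  moreover have "einterval 1 \<infinity> = {1<..}" by (auto simp: einterval_def one_ereal_def)
  ultimately show ?thesis by simp
qed

text \<open>Scaling by 2 is iterated along \<open>a * 2 ^ k\<close>, each doubling costing a factor
  of at most some \<open>q\<close> close to 1; monotonicity covers the points in between. The number
  of doublings is of order \<open>ln s\<close>, so \<open>ln (\<sigma> s)\<close> is at most a small
  multiple of \<open>ln s\<close>.\<close>

lemma slowly_varying_ln_ratio:
  fixes \<sigma> :: "real \<Rightarrow> real"
  assumes mono: "mono_on {1..} \<sigma>" and ge1: "\<And>s. s \<ge> 1 \<Longrightarrow> \<sigma> s \<ge> 1"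
    and slow: "((\<lambda>s. \<sigma> (s * 2) / \<sigma> s) \<longlongrightarrow> 1) at_top"
  shows "((\<lambda>s. ln (\<sigma> s) / ln s) \<longlongrightarrow> 0) at_top"
proof (rule tendstoI)
  fix e :: real assume e: "e > 0"
  \<comment> \<open>With this choice \<open>ln q = e / 2 * ln 2\<close>, and the resulting bound
    tends to \<open>e / 2\<close>, strictly below \<open>e\<close>.\<close>
  define q where "q = 2 powr (e / 2)"
  have "q > 1" using e by (simp add: q_def)
  then have "eventually (\<lambda>s. \<sigma> (s * 2) / \<sigma> s < q) at_top"
    by (intro order_tendstoD(2)[OF slow])
  then obtain a where a: "a \<ge> 1" "\<And>s. s \<ge> a \<Longrightarrow> \<sigma> (s * 2) / \<sigma> s < q"
    unfolding eventually_at_top_linorder by (metis max.bounded_iff max.cobounded2)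
  have step: "\<sigma> (s * 2) \<le> q * \<sigma> s" if "s \<ge> a" for s
    using a(2)[OF that] ge1[of s] a(1) that by (simp add: field_simps)
  have iter: "\<sigma> (a * 2 ^ k) \<le> q ^ k * \<sigma> a" for k
  proof (induction k)
    case (Suc k)
    have "a * 1 \<le> a * 2 ^ k" using a(1) by (intro mult_left_mono) auto
    then have "\<sigma> (a * 2 ^ k * 2) \<le> q * \<sigma> (a * 2 ^ k)" by (intro step) simp
    also have "\<dots> \<le> q * (q ^ k * \<sigma> a)" using Suc \<open>q > 1\<close> by (intro mult_left_mono) auto
    finally show ?case by (simp add: mult_ac)
  qed simp
  have bound: "ln (\<sigma> s) \<le> (log 2 (s / a) + 1) * (e / 2 * ln 2) + ln (\<sigma> a)" if s: "s \<ge> a" for s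
  proof -
    \<comment> \<open>Enough doublings to pass from \<open>a\<close> beyond \<open>s\<close>.
      Rounding up costs at most one extra doubling, a constant that is negligible against
      \<open>ln s\<close>.\<close>
    define k where "k = nat \<lceil>log 2 (s / a)\<rceil>"
    have l0: "log 2 (s / a) \<ge> 0" using s a(1) by simp
    then have k: "log 2 (s / a) \<le> real k" "real k \<le> log 2 (s / a) + 1" unfolding k_def by linarith+
    have "s / a \<le> 2 powr real k" using k(1) s a(1) by (subst (asm) log_le_iff) auto
    then have "s \<le> a * 2 ^ k" using a(1) by (simp add: powr_realpow field_simps)
    then have "\<sigma> s \<le> \<sigma> (a * 2 ^ k)" using s a(1) by (intro mono_onD[OF mono]) auto
    also have "\<dots> \<le> q ^ k * \<sigma> a" by (rule iter)
    finally have "ln (\<sigma> s) \<le> ln (q ^ k * \<sigma> a)" using ge1[of s] s a(1) by (subst ln_le_cancel_iff) auto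
    also have "\<dots> = real k * ln q + ln (\<sigma> a)"
      using ge1[of a] a(1) \<open>q > 1\<close> by (simp add: ln_mult ln_realpow)
    also have "ln q = e / 2 * ln 2" by (simp add: q_def ln_powr)
    also have "real k * (e / 2 * ln 2) \<le> (log 2 (s / a) + 1) * (e / 2 * ln 2)"
      using k(2) e by (intro mult_right_mono) auto
    finally show ?thesis by simp
  qed
  have "((\<lambda>s. ((log 2 (s / a) + 1) * (e / 2 * ln 2) + ln (\<sigma> a)) / ln s) \<longlongrightarrow> e / 2) at_top"
  proof -
    have "((\<lambda>s. (((ln s - ln a) / ln 2 + 1) * (e / 2 * ln 2) + ln (\<sigma> a)) / ln s) \<longlongrightarrow> e / 2) at_top"
      by real_asymp
    moreover have "eventually (\<lambda>s. (((ln s - ln a) / ln 2 + 1) * (e / 2 * ln 2) + ln (\<sigma> a)) / ln s =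
       ((log 2 (s / a) + 1) * (e / 2 * ln 2) + ln (\<sigma> a)) / ln s) at_top"
      using eventually_gt_at_top[of 0] by eventually_elim (use a(1) in \<open>simp add: log_def ln_div\<close>)
    ultimately show ?thesis by (rule Lim_transform_eventually)
  qed
  then have "eventually (\<lambda>s. ((log 2 (s / a) + 1) * (e / 2 * ln 2) + ln (\<sigma> a)) / ln s < e) at_top"
    by (rule order_tendstoD(2)) (use e in auto)
  with eventually_gt_at_top[of 1] eventually_ge_at_top[of a]
  show "eventually (\<lambda>s. dist (ln (\<sigma> s) / ln s) 0 < e) at_top"
  proof eventually_elim
    case (elim s)
    have "ln (\<sigma> s) / ln s \<le> ((log 2 (s / a) + 1) * (e / 2 * ln 2) + ln (\<sigma> a)) / ln s"
      using bound[of s] elim by (intro divide_right_mono) auto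
    moreover have "ln (\<sigma> s) / ln s \<ge> 0" using ge1[of s] elim by simp
    ultimately show ?case using elim by (simp add: dist_real_def)
  qed
qed

section \<open>Pareto exponents of densities and of increasing transforms\<close>

lemma nn_integral_powr_atLeast:
  fixes q y :: real
  assumes "q > 0" "y > 0"
  shows "(\<integral>\<^sup>+s. ennreal (s powr (- q - 1)) * indicator {y..} s \<partial>lborel) = ennreal (y powr (- q) / q)"
proof -
  have "(\<integral>\<^sup>+s. ennreal (s powr (- q - 1)) * indicator {y..} s \<partial>lborel) = ennreal (0 - (- (y powr (- q) / q)))"
  proof (rule nn_integral_FTC_atLeast)
    show "((\<lambda>s. - (s powr (- q) / q)) has_real_derivative x powr (- q - 1)) (at x)" if "y \<le> x" for x
      using that assms by (auto intro!: derivative_eq_intros)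
    show "((\<lambda>s. - (s powr (- q) / q)) \<longlongrightarrow> 0) at_top"
      using assms by real_asymp
  qed auto
  then show ?thesis by simp
qed

text \<open>For small \<open>e\<close> the density eventually lies between the powers of
  \<open>s\<close> with exponents \<open>- (p + e) - 1\<close> and \<open>- (p - e) - 1\<close>.
  Integration bounds the tail by multiples of \<open>y powr (- (p + e))\<close> and
  \<open>y powr (- (p - e))\<close>, and the constant factors are invisible on the logarithmic
  scale.\<close>

lemma pareto_exponent_of_density:
  fixes n :: "real \<Rightarrow> real" and p :: real
  assumes n_pos: "\<And>s. s > 1 \<Longrightarrow> n s > 0"
    and n_int: "set_integrable lborel {1<..} n"
    and n_lim: "((\<lambda>s. ln (n s) / ln s) \<longlongrightarrow> - p - 1) at_top"
    and p: "p > 0"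
  shows "has_pareto_exponent (net_income_distribution n) (\<lambda>s. s) p"
proof -
  define N where "N = (LINT t:{1<..}|lborel. n t)"
  define M where "M = net_income_distribution n"
  have [measurable]: "n \<in> borel_measurable (restrict_space lborel {1<..})"
    using n_int by (simp add: set_integrable_def borel_measurable_restrict_space_iff borel_measurable_integrable)
  \<comment> \<open>Extending the density by 0 moves all integrals from the restricted space to
    \<open>lborel\<close>.\<close>
  define k where "k s = ennreal (n s) * indicator {1<..} s" for s
  have [measurable]: "k \<in> borel_measurable borel"
  proof -
    have "(\<lambda>s. ennreal (indicator {1<..} s *\<^sub>R n s)) \<in> borel_measurable borel"
      using borel_measurable_integrable[OF n_int[unfolded set_integrable_def]] by simp
    moreover have "(\<lambda>s. ennreal (indicator {1<..} s *\<^sub>R n s)) = k"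
      by (auto simp: k_def indicator_def)
    ultimately show ?thesis by simp
  qed
  have k_eq: "(\<integral>\<^sup>+s. k s \<partial>lborel) = ennreal N"
  proof -
    have "(\<integral>\<^sup>+s. k s \<partial>lborel) = (\<integral>\<^sup>+s. ennreal (indicator {1<..} s *\<^sub>R n s) \<partial>lborel)"
      by (intro nn_integral_cong) (auto simp: k_def indicator_def)
    also have "\<dots> = ennreal N"
      using n_int n_pos unfolding N_def set_integrable_def set_lebesgue_integral_def
      by (intro nn_integral_eq_integral) (auto simp: indicator_def less_imp_le)
    finally show ?thesis .
  qed
  have k_pos: "(\<integral>\<^sup>+s. k s * indicator {y..} s \<partial>lborel) > 0" for y
  \<comment> \<open>A vanishing tail would make the unit interval to the right of
    \<open>max 1 y\<close>, on which \<open>k\<close> is positive, a null set.\<close>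
  proof (rule ccontr)
    assume "\<not> ?thesis"
    then have "(\<integral>\<^sup>+s. k s * indicator {y..} s \<partial>lborel) = 0" by simp
    then have "AE s in lborel. k s * indicator {y..} s = 0"
      by (subst (asm) nn_integral_0_iff_AE) auto
    then have "AE s in lborel. s \<notin> {max 1 y<..<max 1 y + 1}"
      by eventually_elim (use n_pos in \<open>force simp: k_def indicator_def split: if_splits\<close>)
    then have "emeasure lborel {max 1 y<..<max 1 y + 1} = 0"
      by (subst (asm) AE_iff_measurable[where N = "{max 1 y<..<max 1 y + 1}"]) auto
    then show False by simp
  qed
  \<comment> \<open>The total mass dominates the tail from 0 on, which is positive by
    \<open>k_pos\<close>.\<close>
  have "ennreal N \<noteq> 0"
    using k_pos[of 0] nn_integral_mono[of lborel "\<lambda>s. k s * indicator {0..} s" k]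
    unfolding k_eq[symmetric] by (fastforce simp: indicator_def)
  then have N: "N > 0" by (simp add: ennreal_eq_0_iff)
  have space_M: "space M = {1<..}"
    by (simp add: M_def net_income_distribution_def space_restrict_space)
  have sets_M: "sets M = sets (restrict_space borel {1<..})"
    by (simp add: M_def net_income_distribution_def sets_restrict_space)
  have emeasure_M: "emeasure M ({1<..} \<inter> B) = (\<integral>\<^sup>+s. k s * indicator B s \<partial>lborel) / ennreal N"
    if [measurable]: "B \<in> sets borel" for B
  proof -
    have "emeasure M ({1<..} \<inter> B) =
      (\<integral>\<^sup>+s. ennreal (n s / N) * indicator ({1<..} \<inter> B) s \<partial>restrict_space lborel {1<..})"
      unfolding M_def net_income_distribution_def N_def[symmetric]
      by (rule emeasure_density) (auto simp: sets_restrict_space)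
    also have "\<dots> = (\<integral>\<^sup>+s. ennreal (n s / N) * indicator ({1<..} \<inter> B) s * indicator {1<..} s \<partial>lborel)"
      by (subst nn_integral_restrict_space) auto
    also have "\<dots> = (\<integral>\<^sup>+s. k s * indicator B s / ennreal N \<partial>lborel)"
    proof (rule nn_integral_cong)
      fix s :: real
      show "ennreal (n s / N) * indicator ({1<..} \<inter> B) s * indicator {1<..} s = k s * indicator B s / ennreal N"
        using N n_pos[of s] by (auto simp: k_def indicator_def divide_ennreal less_imp_le)
    qed
    also have "\<dots> = (\<integral>\<^sup>+s. k s * indicator B s \<partial>lborel) / ennreal N"
      by (intro nn_integral_divide) measurable
    finally show ?thesis .
  qed
  have prob: "prob_space M"
  proof
    show "emeasure M (space M) = 1"
      using emeasure_M[of UNIV] N by (simp add: space_M k_eq)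
  qed
  interpret prob_space M by (rule prob)
  define T where "T y = measure M {s \<in> space M. s \<ge> y}" for y
  have T: "ennreal (T y) = (\<integral>\<^sup>+s. k s * indicator {y..} s \<partial>lborel) / ennreal N" for y
  proof -
    have "{s \<in> space M. s \<ge> y} = {1<..} \<inter> {y..}" by (auto simp: space_M)
    then show ?thesis using emeasure_M[of "{y..}"] by (simp add: T_def emeasure_eq_measure)
  qed
  have T_pos: "T y > 0" for y
  proof -
    have "ennreal (T y) > 0" using k_pos[of y] unfolding T by (auto simp: ennreal_zero_less_divide)
    then show ?thesis by simp
  qed
  have T_lim: "((\<lambda>y. - (ln (T y) / ln y)) \<longlongrightarrow> p) at_top"
  proof (rule tendstoI)
    fix e0 :: real assume e0: "e0 > 0"
    \<comment> \<open>Besides \<open>e < e0\<close>, this ensures \<open>e < p\<close>, so that the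
      power with exponent \<open>- (p - e) - 1\<close> still has a finite tail integral.\<close>
    define e where "e = min e0 p / 2"
    have e: "e > 0" "e < p" "e < e0" using e0 p by (auto simp: e_def min_def)
    have "eventually (\<lambda>s. \<bar>ln (n s) / ln s - (- p - 1)\<bar> < e) at_top"
      using tendstoD[OF n_lim e(1)] by (simp add: dist_real_def)
    then obtain a where a: "a > 1" "\<And>s. s \<ge> a \<Longrightarrow> \<bar>ln (n s) / ln s - (- p - 1)\<bar> < e"
      using eventually_conj[OF eventually_gt_at_top[of 1]] unfolding eventually_at_top_linorder
      by (metis order.refl)
    have n_bounds: "s powr (- (p + e) - 1) \<le> n s" "n s \<le> s powr (- (p - e) - 1)" if "s \<ge> a" for s
    proof -
      have s: "s > 1" using that a by simp
      then have l: "ln s > 0" by simp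
      have "ln (n s) / ln s \<ge> - (p + e) - 1" "ln (n s) / ln s \<le> - (p - e) - 1"
        using a(2)[OF that] by linarith+
      then have "(- (p + e) - 1) * ln s \<le> ln (n s)" "ln (n s) \<le> (- (p - e) - 1) * ln s"
        using l by (simp_all add: pos_le_divide_eq pos_divide_le_eq)
      then have "exp ((- (p + e) - 1) * ln s) \<le> exp (ln (n s))" "exp (ln (n s)) \<le> exp ((- (p - e) - 1) * ln s)"
        by simp_all
      then show "s powr (- (p + e) - 1) \<le> n s" "n s \<le> s powr (- (p - e) - 1)"
        using s n_pos[OF s] by (auto simp: powr_def)
    qed
    have T_bounds: "y powr (- (p + e)) / (p + e) / N \<le> T y" "T y \<le> y powr (- (p - e)) / (p - e) / N"
      if y: "y \<ge> a" for y
    proof -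
      have "ennreal (y powr (- (p + e)) / (p + e)) =
         (\<integral>\<^sup>+s. ennreal (s powr (- (p + e) - 1)) * indicator {y..} s \<partial>lborel)"
        using e p y a by (intro nn_integral_powr_atLeast[symmetric]) auto
      also have "\<dots> \<le> (\<integral>\<^sup>+s. k s * indicator {y..} s \<partial>lborel)"
        using n_bounds(1) y a by (intro nn_integral_mono) (auto simp: k_def indicator_def intro!: ennreal_leI)
      finally have "ennreal (y powr (- (p + e)) / (p + e)) / ennreal N \<le> ennreal (T y)"
        unfolding T by (rule divide_right_mono_ennreal)
      then show "y powr (- (p + e)) / (p + e) / N \<le> T y"
        using N e p T_pos[of y] by (simp add: divide_ennreal)
      have "(\<integral>\<^sup>+s. k s * indicator {y..} s \<partial>lborel) \<le>
         (\<integral>\<^sup>+s. ennreal (s powr (- (p - e) - 1)) * indicator {y..} s \<partial>lborel)"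
        using n_bounds(2) y a by (intro nn_integral_mono) (auto simp: k_def indicator_def intro!: ennreal_leI)
      also have "\<dots> = ennreal (y powr (- (p - e)) / (p - e))"
        using e p y a by (intro nn_integral_powr_atLeast) auto
      finally have "ennreal (T y) \<le> ennreal (y powr (- (p - e)) / (p - e)) / ennreal N"
        unfolding T by (rule divide_right_mono_ennreal)
      then show "T y \<le> y powr (- (p - e)) / (p - e) / N"
        using N e p by (simp add: divide_ennreal)
    qed
    \<comment> \<open>The logarithms of \<open>(p + e) * N\<close> and \<open>(p - e) * N\<close>
      are divided by \<open>ln y\<close>, so the bounds tend to \<open>p + e\<close> and
      \<open>p - e\<close>, strictly within \<open>e0\<close> of \<open>p\<close>.\<close>
    have "((\<lambda>y. (p + e) + ln ((p + e) * N) / ln y) \<longlongrightarrow> p + e) at_top" by real_asymp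
    then have "eventually (\<lambda>y. (p + e) + ln ((p + e) * N) / ln y < p + e0) at_top"
      by (rule order_tendstoD) (use e in simp)
    moreover have "((\<lambda>y. (p - e) + ln ((p - e) * N) / ln y) \<longlongrightarrow> p - e) at_top" by real_asymp
    then have "eventually (\<lambda>y. (p - e) + ln ((p - e) * N) / ln y > p - e0) at_top"
      by (rule order_tendstoD) (use e in simp)
    moreover note eventually_ge_at_top[of a]
    ultimately
    show "eventually (\<lambda>y. dist (- (ln (T y) / ln y)) p < e0) at_top"
    proof eventually_elim
      case (elim y)
      then have y: "y > 1" "ln y > 0" using a by auto
      have ln_eq: "ln (y powr (- q) / q / N) = - (q * ln y + ln (q * N))" if "q > 0" for q
        using that y N by (simp add: ln_div ln_mult ln_powr)
      have "ln (y powr (- (p + e)) / (p + e) / N) \<le> ln (T y)" "ln (T y) \<le> ln (y powr (- (p - e)) / (p - e) / N)"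
        using T_bounds[of y] elim T_pos[of y] y e p N by (auto intro!: ln_mono divide_pos_pos)
      then have "- ln (T y) \<le> (p + e) * ln y + ln ((p + e) * N)"
        "(p - e) * ln y + ln ((p - e) * N) \<le> - ln (T y)"
        using ln_eq[of "p + e"] ln_eq[of "p - e"] e p by simp_all
      then have "- ln (T y) / ln y \<le> ((p + e) * ln y + ln ((p + e) * N)) / ln y"
        "((p - e) * ln y + ln ((p - e) * N)) / ln y \<le> - ln (T y) / ln y"
        using y by (intro divide_right_mono; simp)+
      then have "- ln (T y) / ln y \<le> (p + e) + ln ((p + e) * N) / ln y"
        "(p - e) + ln ((p - e) * N) / ln y \<le> - ln (T y) / ln y"
        using y by (simp_all add: add_divide_distrib)
      with elim show ?case by (simp add: dist_real_def abs_less_iff)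
    qed
  qed
  have "(\<lambda>s. s) \<in> borel_measurable M"
    by (simp add: measurable_cong_sets[OF sets_M refl] measurable_restrict_space1)
  moreover have "AE s in M. s > 0"
    using AE_space by eventually_elim (auto simp: space_M)
  ultimately show ?thesis
    unfolding has_pareto_exponent_def M_def[symmetric] using prob T_pos T_lim by (simp add: T_def)
qed

text \<open>With \<open>f\<close> inverse to \<open>g\<close>, the tail of \<open>g\<close> at
  \<open>z\<close> is the tail of the identity at \<open>f z\<close>, and
  \<open>ln z = ln (g (f z))\<close> is asymptotically \<open>q * ln (f z)\<close>. Hence the
  exponent is divided by \<open>q\<close>.\<close>

lemma pareto_exponent_strict_mono_transform:
  fixes M :: "real measure" and g :: "real \<Rightarrow> real"
  assumes M: "has_pareto_exponent M (\<lambda>s. s) p" and space_M: "space M = {1<..}"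
    and g_meas: "g \<in> borel_measurable M"
    and g_cont: "continuous_on {1..} g" and g_mono: "strict_mono_on {1..} g"
    and g_ge: "\<And>s. s \<ge> 1 \<Longrightarrow> g s \<ge> s"
    and g_lim: "((\<lambda>s. ln (g s) / ln s) \<longlongrightarrow> q) at_top" and q: "q > 0"
  shows "has_pareto_exponent M g (p / q)"
proof -
  interpret prob_space M using M by (simp add: has_pareto_exponent_def)
  have id_meas [measurable]: "(\<lambda>s. s) \<in> borel_measurable M"
    using M by (simp add: has_pareto_exponent_def)
  note g_meas[measurable]
  define T where "T y = measure M {s \<in> space M. s \<ge> y}" for y
  have T_pos: "T y > 0" and T_lim: "((\<lambda>y. - (ln (T y) / ln y)) \<longlongrightarrow> p) at_top" for y
    using M by (auto simp: has_pareto_exponent_def T_def)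
  \<comment> \<open>Intermediate values on \<open>{1..max 1 z}\<close>: the bound
    \<open>g s \<ge> s\<close> makes \<open>g\<close> at the right end at least
    \<open>z\<close>.\<close>
  have ex: "\<exists>s\<ge>1. g s = z" if "z \<ge> g 1" for z
  proof -
    have "\<exists>s. 1 \<le> s \<and> s \<le> max 1 z \<and> g s = z"
      using that g_ge[of "max 1 z"] by (intro IVT') (auto intro: continuous_on_subset[OF g_cont])
    then show ?thesis by blast
  qed
  define f where "f z = (SOME s. s \<ge> 1 \<and> g s = z)" for z
  have f: "f z \<ge> 1" "g (f z) = z" if "z \<ge> g 1" for z
    using someI_ex[of "\<lambda>s. s \<ge> 1 \<and> g s = z"] ex[OF that] unfolding f_def by blast+
  have f_top: "filterlim f at_top at_top"
    unfolding filterlim_at_top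
  proof
    fix K :: real
    show "eventually (\<lambda>z. K \<le> f z) at_top"
      using eventually_ge_at_top[of "g 1"] eventually_gt_at_top[of "g (max 1 K)"]
    proof eventually_elim
      case (elim z)
      show ?case
      proof (rule ccontr)
        assume "\<not> K \<le> f z"
        then have "g (f z) \<le> g (max 1 K)"
          using f[of z] elim by (intro strict_mono_on_leD[OF g_mono]) auto
        then show False using f[of z] elim by simp
      qed
    qed
  qed
  have tail: "measure M {s \<in> space M. g s \<ge> z} = T (f z)" if z: "z \<ge> g 1" for z
  proof -
    have "g s \<ge> z \<longleftrightarrow> s \<ge> f z" if "s > 1" for s
      using strict_mono_on_less_eq[OF g_mono, of "f z" s] f[OF z] that by auto
    then have "{s \<in> space M. g s \<ge> z} = {s \<in> space M. s \<ge> f z}" by (auto simp: space_M)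
    then show ?thesis by (simp add: T_def)
  qed
  \<comment> \<open>The factor \<open>ln (f z)\<close> cancels once \<open>f z > 1\<close>, and
    \<open>g (f z) = z\<close> turns the quotient into the one defining the exponent of
    \<open>g\<close>.\<close>
  have "((\<lambda>z. - (ln (T (f z)) / ln (f z)) / (ln (g (f z)) / ln (f z))) \<longlongrightarrow> p / q) at_top"
    using filterlim_compose[OF T_lim f_top] filterlim_compose[OF g_lim f_top] q
    by (intro tendsto_divide) auto
  moreover have "eventually (\<lambda>z. - (ln (T (f z)) / ln (f z)) / (ln (g (f z)) / ln (f z)) =
      - (ln (measure M {s \<in> space M. g s \<ge> z}) / ln z)) at_top"
    using eventually_ge_at_top[of "g 1"] filterlim_at_top_dense[THEN iffD1, rule_format, OF f_top, of 1]
    by eventually_elim (simp add: tail f)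
  ultimately have lim: "((\<lambda>z. - (ln (measure M {s \<in> space M. g s \<ge> z}) / ln z)) \<longlongrightarrow> p / q) at_top"
    by (rule Lim_transform_eventually)
  have pos: "measure M {s \<in> space M. g s \<ge> z} > 0" for z
  proof -
    have "T z \<le> measure M {s \<in> space M. g s \<ge> z}"
      unfolding T_def
    proof (rule finite_measure_mono)
      show "{s \<in> space M. z \<le> s} \<subseteq> {s \<in> space M. z \<le> g s}"
        using g_ge by (auto simp: space_M intro: order.trans less_imp_le)
    qed measurable
    with T_pos[of z] show ?thesis by simp
  qed
  have "AE s in M. g s > 0"
    using AE_space
  proof eventually_elim
    case (elim s)
    then have "s > 1" by (simp add: space_M)
    with g_ge[of s] show ?case by linarith
  qed
  then show ?thesis
    unfolding has_pareto_exponent_def using pos lim g_meas prob_space_axioms by auto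
qed

section \<open>From the balance equation to the moment of \<open>R\<close> and the two
  exponents\<close>

lemma continuous_on_Icc_upper_bound:
  fixes f :: "real \<Rightarrow> real"
  assumes "continuous_on {a..c} f"
  shows "\<exists>C>0. \<forall>x\<in>{a..c}. f x \<le> C"
proof -
  have "bounded (f ` {a..c})"
    using assms by (intro compact_imp_bounded compact_continuous_image) auto
  then show ?thesis unfolding bounded_pos by (auto simp: abs_le_iff)
qed

lemma tendsto_comp_inverse_at_top:
  fixes f :: "real \<Rightarrow> real"
  assumes "continuous_on {0..1} f"
  shows "((\<lambda>s. f (1 / s)) \<longlongrightarrow> f 0) at_top"
proof (rule continuous_on_tendsto_compose[OF assms])
  show "((\<lambda>s::real. 1 / s) \<longlongrightarrow> 0) at_top" by real_asymp
  show "eventually (\<lambda>s::real. 1 / s \<in> {0..1}) at_top"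
    using eventually_ge_at_top[of 1] by eventually_elim auto
qed simp

text \<open>The factor \<open>\<sigma> y\<close> in the balance integral cancels the denominator of
  \<open>n y\<close>, leaving a convolution of \<open>R\<close> with
  \<open>y powr (- b) * h y\<close>. Where \<open>P\<close> vanishes, the other side has the form
  treated above with \<open>L s = (1 / \<sigma> s + R0) * h s\<close>, whose limit is
  \<open>(R0 + w) * \<rho> 0\<close>; the factor \<open>\<rho> 0\<close>, the limit of
  \<open>h\<close>, drops out.\<close>

lemma R_moment_identity:
  fixes R P \<sigma> n \<rho> :: "real \<Rightarrow> real" and R0 b d w :: real
  assumes R_nonneg: "\<And>y. y \<ge> 1 \<Longrightarrow> R y \<ge> 0" and R_cont: "continuous_on {1..} R" and R0_pos: "R0 > 0"
    and \<sigma>_ge: "\<And>s. s \<ge> 1 \<Longrightarrow> \<sigma> s \<ge> 1"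
    and \<sigma>_lim: "((\<lambda>s. 1 / \<sigma> s) \<longlongrightarrow> w) at_top" and w: "w \<ge> 0"
    and P_vanishes: "eventually (\<lambda>s. P s = 0) at_top"
    and balance: "\<And>s. s > 1 \<Longrightarrow>
          (LINT y:{1<..<s}|lborel. \<sigma> y * R (s / y) * n y) = (s - P s + s * \<sigma> s * R0) * n s"
    and n_eq: "\<And>s. s > 1 \<Longrightarrow> n s = s powr (- b) * ((1 - 1 / s) powr d * \<rho> (1 / s)) / \<sigma> s"
    and d_gt: "d > -1"
    and rho_cont: "continuous_on {0..1} \<rho>"
    and rho_pos: "\<And>x. 0 \<le> x \<Longrightarrow> x \<le> 1 \<Longrightarrow> \<rho> x > 0"
  shows "set_integrable lborel {1..} (\<lambda>t. t powr (b - 2) * R t)"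
    and "(LINT t:{1..}|lborel. t powr (b - 2) * R t) = R0 + w"
proof -
  define R' where "R' t = indicator {1..} t *\<^sub>R R t" for t :: real
  define h0 where "h0 s = (1 - 1 / s) powr d * \<rho> (1 / s)" for s :: real
  define h where "h s = indicator {1<..} s *\<^sub>R h0 s" for s :: real
  have R'_meas [measurable]: "R' \<in> borel_measurable borel"
    unfolding R'_def using R_cont by (intro borel_measurable_continuous_on_indicator) auto
  have R'_nonneg: "0 \<le> R' t" for t using R_nonneg by (auto simp: R'_def indicator_def)
  have h0_cont: "continuous_on {1<..} h0"
    unfolding h0_def
    by (intro continuous_intros continuous_on_compose2[OF rho_cont]) (auto simp: field_simps)
  have h_meas [measurable]: "h \<in> borel_measurable borel"
    unfolding h_def using h0_cont by (intro borel_measurable_continuous_on_indicator) auto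
  have h0_pos: "h0 s > 0" if "s > 1" for s
    using that rho_pos[of "1 / s"] by (auto simp: h0_def)
  obtain C where C: "C > 0" "\<And>x. x \<in> {0..1} \<Longrightarrow> \<rho> x \<le> C"
    using continuous_on_Icc_upper_bound[OF rho_cont] by blast
  have "(\<integral>\<^sup>+t. ennreal (t powr (b - 2) * R' t) \<partial>lborel) = ennreal (((R0 + w) * \<rho> 0) / \<rho> 0)"
  proof (rule mellin_moment_of_convolution_limit)
    show "0 \<le> h s" for s using h0_pos[of s] by (auto simp: h_def indicator_def less_imp_le)
    show "h s = 0" if "s \<le> 1" for s using that by (simp add: h_def)
    show "0 \<le> R' t" for t by (rule R'_nonneg)
    show "R' t = 0" if "t < 1" for t using that by (simp add: R'_def)
    show h_lim: "(h \<longlongrightarrow> \<rho> 0) at_top"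
    proof -
      have "((\<lambda>s. \<rho> (1 / s)) \<longlongrightarrow> \<rho> 0) at_top" by (rule tendsto_comp_inverse_at_top[OF rho_cont])
      moreover have "((\<lambda>s::real. (1 - 1 / s) powr d) \<longlongrightarrow> 1) at_top" by real_asymp
      ultimately have "(h0 \<longlongrightarrow> 1 * \<rho> 0) at_top" unfolding h0_def by (intro tendsto_mult)
      moreover have "eventually (\<lambda>s. h0 s = h s) at_top"
        using eventually_gt_at_top[of 1] by eventually_elim (simp add: h_def)
      ultimately show ?thesis by (auto intro: Lim_transform_eventually)
    qed
    show "0 < \<rho> 0" by (intro rho_pos) auto
    then show "0 < (R0 + w) * \<rho> 0" using R0_pos w by simp
    show "(\<integral>\<^sup>+y. ennreal (h y / y) * indicator {1..s} y \<partial>lborel) < \<infinity>" for s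
    proof -
      \<comment> \<open>For \<open>1 < y \<le> s\<close> one has
        \<open>1 / y = y * y powr (-2) \<le> s * y powr (-2)\<close>, so the integrable function at
        1 found above dominates.\<close>
      let ?\<beta> = "\<lambda>y. indicator {1<..} y *\<^sub>R ((1 - 1 / y) powr d * y powr (-2))"
      have "(\<integral>\<^sup>+y. ennreal (h y / y) * indicator {1..s} y \<partial>lborel) \<le>
        (\<integral>\<^sup>+y. ennreal (norm (C * max s 0 * ?\<beta> y)) \<partial>lborel)"
      proof (rule nn_integral_mono)
        fix y :: real
        show "ennreal (h y / y) * indicator {1..s} y \<le> ennreal (norm (C * max s 0 * ?\<beta> y))"
        proof (cases "1 < y \<and> y \<le> s")
          case True
          then have "h y / y \<le> (1 - 1 / y) powr d * C / y"
            using C(2)[of "1 / y"] by (auto simp: h_def h0_def intro!: divide_right_mono mult_left_mono)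
          also have "\<dots> = C * y * ((1 - 1 / y) powr d * y powr (-2))"
            using True by (simp add: powr_minus_divide power2_eq_square field_simps)
          also have "\<dots> \<le> C * s * ((1 - 1 / y) powr d * y powr (-2))"
            using True C(1) by (intro mult_right_mono mult_left_mono) auto
          also have "\<dots> = norm (C * max s 0 * ?\<beta> y)"
            using True C(1) by (simp add: abs_mult)
          finally show ?thesis using True by (simp add: ennreal_leI)
        qed (auto simp: h_def indicator_def)
      qed
      also have "\<dots> < \<infinity>"
        using integrable_mult_right[of "C * max s 0" lborel ?\<beta>] set_integrable_beta_at_1[OF d_gt]
        unfolding integrable_iff_bounded set_integrable_def by blast
      finally show ?thesis .
    qed
    show "((\<lambda>s. (1 / \<sigma> s + R0) * h s) \<longlongrightarrow> (R0 + w) * \<rho> 0) at_top"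
      using tendsto_mult[OF tendsto_add[OF \<sigma>_lim tendsto_const[of R0]] h_lim] by (simp add: add.commute)
    show "eventually (\<lambda>s. (\<integral>\<^sup>+y. ennreal (R' (s / y) * (y powr (- b) * h y)) \<partial>lborel) =
                 ennreal (s powr (1 - b) * ((1 / \<sigma> s + R0) * h s))) at_top"
      using P_vanishes eventually_gt_at_top[of 1]
    proof eventually_elim
      case (elim s)
      define f where "f y = indicator {1<..<s} y *\<^sub>R (\<sigma> y * R (s / y) * n y)" for y
      \<comment> \<open>At \<open>y = s\<close> the open range of integration gives 0 while
        \<open>R' (s / y) = R 1\<close> need not vanish; one point is a null set.\<close>
      have f_eq: "f y = R' (s / y) * (y powr (- b) * h y)" if "y \<noteq> s" for y
      proof (cases "1 < y \<and> y < s")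
        case True
        then show ?thesis using elim \<sigma>_ge[of y]
          by (simp add: f_def R'_def h_def n_eq h0_def)
      next
        case False
        then have "y \<le> 1 \<or> s / y < 1" using that elim by (auto simp: field_simps)
        then show ?thesis using False by (auto simp: f_def R'_def h_def)
      qed
      have v: "integral\<^sup>L lborel f = s powr (1 - b) * ((1 / \<sigma> s + R0) * h s)"
      proof -
        have "integral\<^sup>L lborel f = (s + s * \<sigma> s * R0) * n s"
          using balance[of s] elim by (simp add: f_def[abs_def] set_lebesgue_integral_def)
        also have "\<dots> = s powr (1 - b) * ((1 / \<sigma> s + R0) * h s)"
          using elim \<sigma>_ge[of s]
          by (simp add: n_eq h_def h0_def powr_diff powr_minus field_simps)
        finally show ?thesis .
      qed
      \<comment> \<open>Integrability of the balance integrand comes from its value: a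
        non-integrable function would have integral 0 by convention, whereas the right-hand side is
        positive.\<close>
      have "s powr (1 - b) * ((1 / \<sigma> s + R0) * h s) > 0"
        using elim \<sigma>_ge[of s] R0_pos h0_pos[of s] by (auto simp: h_def intro!: mult_pos_pos add_pos_pos)
      with v have "integrable lborel f" using not_integrable_integral_eq by fastforce
      moreover have "AE y in lborel. 0 \<le> f y"
      proof (rule AE_I2)
        fix y show "0 \<le> f y"
          using R_nonneg[of "s / y"] \<sigma>_ge[of y] rho_pos[of "1 / y"]
          by (auto simp: f_def indicator_def n_eq intro!: mult_nonneg_nonneg divide_nonneg_nonneg)
      qed
      ultimately have "(\<integral>\<^sup>+y. ennreal (f y) \<partial>lborel) = ennreal (integral\<^sup>L lborel f)"
        by (rule nn_integral_eq_integral)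
      moreover have "(\<integral>\<^sup>+y. ennreal (R' (s / y) * (y powr (- b) * h y)) \<partial>lborel) = (\<integral>\<^sup>+y. ennreal (f y) \<partial>lborel)"
        by (rule nn_integral_cong_AE, use AE_lborel_singleton[of s] in eventually_elim) (simp add: f_eq)
      ultimately show ?case using v by simp
    qed
  qed measurable
  also have "((R0 + w) * \<rho> 0) / \<rho> 0 = R0 + w" using rho_pos[of 0] by simp
  finally have "has_bochner_integral lborel (\<lambda>t. t powr (b - 2) * R' t) (R0 + w)"
    using R'_nonneg R0_pos w by (intro has_bochner_integral_nn_integral) auto
  moreover have "(\<lambda>t. t powr (b - 2) * R' t) = (\<lambda>t. indicator {1..} t *\<^sub>R (t powr (b - 2) * R t))"
    by (auto simp: R'_def)
  ultimately show "set_integrable lborel {1..} (\<lambda>t. t powr (b - 2) * R t)"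
    "(LINT t:{1..}|lborel. t powr (b - 2) * R t) = R0 + w"
    by (auto simp: set_integrable_def set_lebesgue_integral_def has_bochner_integral_iff)
qed

text \<open>On the logarithmic scale \<open>n s\<close> behaves like
  \<open>s powr (- b - k)\<close>, and gross income \<open>s * (1 + \<sigma> s * R0)\<close> like
  \<open>s powr (1 + k)\<close>. The first gives the net exponent, the second divides it by
  \<open>1 + k\<close>.\<close>

lemma income_pareto_exponents:
  fixes \<sigma> n \<rho> :: "real \<Rightarrow> real" and R0 b d k :: real
  assumes R0_pos: "R0 > 0"
    and \<sigma>_cont: "continuous_on {1..} \<sigma>" and \<sigma>_mono: "mono_on {1..} \<sigma>"
    and \<sigma>_ge: "\<And>s. s \<ge> 1 \<Longrightarrow> \<sigma> s \<ge> 1"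
    and \<sigma>_lim: "((\<lambda>s. ln (\<sigma> s) / ln s) \<longlongrightarrow> k) at_top" and k: "k \<ge> 0"
    and n_eq: "\<And>s. s > 1 \<Longrightarrow> n s = s powr (- b) * ((1 - 1 / s) powr d * \<rho> (1 / s)) / \<sigma> s"
    and b: "b \<ge> 2" and d_gt: "d > -1"
    and rho_cont: "continuous_on {0..1} \<rho>"
    and rho_pos: "\<And>x. 0 \<le> x \<Longrightarrow> x \<le> 1 \<Longrightarrow> \<rho> x > 0"
  shows "has_pareto_exponent (net_income_distribution n) (\<lambda>s. s) (b - 1 + k)"
    and "has_pareto_exponent (net_income_distribution n) (gross_income \<sigma> R0) ((b - 1 + k) / (1 + k))"
proof -
  obtain C where C: "C > 0" "\<And>x. x \<in> {0..1} \<Longrightarrow> \<rho> x \<le> C"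
    using continuous_on_Icc_upper_bound[OF rho_cont] by blast
  have n_pos: "n s > 0" if "s > 1" for s
    using that rho_pos[of "1 / s"] \<sigma>_ge[of s] by (simp add: n_eq)
  have n_int: "set_integrable lborel {1<..} n"
  proof (rule set_integrable_bound)
    \<comment> \<open>Domination: \<open>\<rho> \<le> C\<close>, \<open>\<sigma> \<ge> 1\<close>,
      and \<open>b \<ge> 2\<close> gives \<open>s powr (- b) \<le> s powr (-2)\<close>.\<close>
    show "set_integrable lborel {1<..} (\<lambda>s. C * ((1 - 1 / s) powr d * s powr (-2)))"
      using set_integrable_beta_at_1[OF d_gt] by (rule set_integrable_mult_right)
    have "\<forall>s\<in>{1<..}. \<sigma> s \<noteq> 0" using \<sigma>_ge by (metis greaterThan_iff less_imp_le not_one_le_zero)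
    then have "continuous_on {1<..} (\<lambda>s. s powr (- b) * ((1 - 1 / s) powr d * \<rho> (1 / s)) / \<sigma> s)"
      by (intro continuous_intros continuous_on_compose2[OF rho_cont] continuous_on_subset[OF \<sigma>_cont])
        (auto simp: field_simps)
    then have "continuous_on {1<..} n" by (rule continuous_on_eq) (simp add: n_eq)
    then show "set_borel_measurable lborel {1<..} n"
      unfolding set_borel_measurable_def measurable_lborel2
      by (intro borel_measurable_continuous_on_indicator) auto
    show "AE s in lborel. s \<in> {1<..} \<longrightarrow> norm (n s) \<le> norm (C * ((1 - 1 / s) powr d * s powr (-2)))"
    proof (intro AE_I2 impI)
      fix s :: real assume s: "s \<in> {1<..}"
      have "n s \<le> s powr (- b) * ((1 - 1 / s) powr d * \<rho> (1 / s)) / 1"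
        using s \<sigma>_ge[of s] rho_pos[of "1 / s"] unfolding n_eq[of s, OF s[unfolded greaterThan_iff]]
        by (intro divide_left_mono) auto
      also have "\<dots> \<le> s powr (-2) * ((1 - 1 / s) powr d * C) / 1"
        using s b C(2)[of "1 / s"] rho_pos[of "1 / s"]
        by (intro divide_right_mono mult_mono[OF powr_mono mult_left_mono]) auto
      finally show "norm (n s) \<le> norm (C * ((1 - 1 / s) powr d * s powr (-2)))"
        using n_pos[of s] s C(1) by (simp add: abs_mult mult_ac)
    qed
  qed
  \<comment> \<open>Only \<open>s powr (- b)\<close> and \<open>1 / \<sigma> s\<close> matter after
    division by \<open>ln s\<close>; the logarithms of \<open>(1 - 1 / s) powr d\<close> and
    \<open>\<rho> (1 / s)\<close> converge.\<close>
  have n_lim: "((\<lambda>s. ln (n s) / ln s) \<longlongrightarrow> - (b - 1 + k) - 1) at_top"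
  proof -
    have ln_top: "filterlim ln at_infinity (at_top :: real filter)"
      using ln_at_top by (rule filterlim_at_top_imp_at_infinity)
    have "((\<lambda>s. \<rho> (1 / s)) \<longlongrightarrow> \<rho> 0) at_top" by (rule tendsto_comp_inverse_at_top[OF rho_cont])
    then have "((\<lambda>s. ln (\<rho> (1 / s))) \<longlongrightarrow> ln (\<rho> 0)) at_top"
      using rho_pos[of 0] by (intro tendsto_ln) auto
    then have "((\<lambda>s. ln (\<rho> (1 / s)) / ln s) \<longlongrightarrow> 0) at_top"
      using ln_top by (rule tendsto_divide_0)
    moreover have "((\<lambda>s. - b + d * ln (1 - 1 / s) / ln s) \<longlongrightarrow> - b) at_top" by real_asymp
    ultimately have "((\<lambda>s. (- b + d * ln (1 - 1 / s) / ln s) + ln (\<rho> (1 / s)) / ln s - ln (\<sigma> s) / ln s)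
        \<longlongrightarrow> - b + 0 - k) at_top"
      using \<sigma>_lim by (intro tendsto_intros)
    moreover have "eventually (\<lambda>s. (- b + d * ln (1 - 1 / s) / ln s) + ln (\<rho> (1 / s)) / ln s - ln (\<sigma> s) / ln s
        = ln (n s) / ln s) at_top"
      using eventually_gt_at_top[of 1]
    proof eventually_elim
      case (elim s)
      then have "ln (n s) = - b * ln s + d * ln (1 - 1 / s) + ln (\<rho> (1 / s)) - ln (\<sigma> s)"
        using rho_pos[of "1 / s"] \<sigma>_ge[of s] by (simp add: n_eq ln_div ln_mult ln_powr)
      with elim show ?case by (simp add: add_divide_distrib diff_divide_distrib)
    qed
    ultimately show ?thesis by (auto intro: Lim_transform_eventually)
  qed
  show net: "has_pareto_exponent (net_income_distribution n) (\<lambda>s. s) (b - 1 + k)"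
    using b k by (intro pareto_exponent_of_density n_pos n_int n_lim) auto
  let ?g = "gross_income \<sigma> R0"
  have g_cont: "continuous_on {1..} ?g"
    unfolding gross_income_def by (intro continuous_intros \<sigma>_cont)
  show "has_pareto_exponent (net_income_distribution n) ?g ((b - 1 + k) / (1 + k))"
  proof (rule pareto_exponent_strict_mono_transform[OF net])
    show "space (net_income_distribution n) = {1<..}"
      by (simp add: net_income_distribution_def space_restrict_space)
    have "?g \<in> borel_measurable (restrict_space borel {1<..})"
      by (intro borel_measurable_continuous_on_restrict continuous_on_subset[OF g_cont]) auto
    then show "?g \<in> borel_measurable (net_income_distribution n)"
      by (simp add: net_income_distribution_def measurable_def space_restrict_space sets_restrict_space)
    show "continuous_on {1..} ?g" by (rule g_cont)
    show "strict_mono_on {1..} ?g"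
    proof (rule strict_mono_onI)
      fix s t :: real assume st: "s \<in> {1..}" "t \<in> {1..}" "s < t"
      have "\<sigma> s \<le> \<sigma> t" using st by (intro mono_onD[OF \<sigma>_mono]) auto
      then have "1 + \<sigma> s * R0 \<le> 1 + \<sigma> t * R0" using R0_pos by simp
      moreover have "1 + \<sigma> s * R0 > 0" using \<sigma>_ge[of s] st R0_pos by (simp add: add_pos_nonneg)
      ultimately show "?g s < ?g t" unfolding gross_income_def
        using st by (intro mult_less_le_imp_less) auto
    qed
    show "?g s \<ge> s" if "s \<ge> 1" for s
      using that \<sigma>_ge[of s] R0_pos by (simp add: gross_income_def algebra_simps)
    show "((\<lambda>s. ln (?g s) / ln s) \<longlongrightarrow> 1 + k) at_top"
    \<comment> \<open>As \<open>\<sigma> s \<ge> 1\<close>, the factor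
      \<open>1 + \<sigma> s * R0\<close> lies between \<open>\<sigma> s * R0\<close> and
      \<open>\<sigma> s * (1 + R0)\<close>.\<close>
    proof (rule tendsto_sandwich)
      show "eventually (\<lambda>s. 1 + ln (\<sigma> s) / ln s + ln R0 / ln s \<le> ln (?g s) / ln s) at_top"
        using eventually_gt_at_top[of 1]
      proof eventually_elim
        case (elim s)
        have "ln (s * (\<sigma> s * R0)) \<le> ln (?g s)" unfolding gross_income_def
          using elim \<sigma>_ge[of s] R0_pos by (intro ln_mono mult_left_mono mult_pos_pos) auto
        then have "ln s + ln (\<sigma> s) + ln R0 \<le> ln (?g s)"
          using elim \<sigma>_ge[of s] R0_pos by (simp add: ln_mult)
        then have "(ln s + ln (\<sigma> s) + ln R0) / ln s \<le> ln (?g s) / ln s"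
          using elim by (intro divide_right_mono) auto
        then show ?case using elim by (simp add: add_divide_distrib)
      qed
      show "eventually (\<lambda>s. ln (?g s) / ln s \<le> 1 + ln (\<sigma> s) / ln s + ln (1 + R0) / ln s) at_top"
        using eventually_gt_at_top[of 1]
      proof eventually_elim
        case (elim s)
        have "1 + \<sigma> s * R0 > 0" using \<sigma>_ge[of s] elim R0_pos by (simp add: add_pos_nonneg)
        then have "ln (?g s) \<le> ln (s * (\<sigma> s * (1 + R0)))" unfolding gross_income_def
          using elim \<sigma>_ge[of s] by (intro ln_mono mult_left_mono mult_pos_pos) (auto simp: algebra_simps)
        then have "ln (?g s) \<le> ln s + ln (\<sigma> s) + ln (1 + R0)"
          using elim \<sigma>_ge[of s] R0_pos by (simp add: ln_mult)
        then have "ln (?g s) / ln s \<le> (ln s + ln (\<sigma> s) + ln (1 + R0)) / ln s"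
          using elim by (intro divide_right_mono) auto
        then show ?case using elim by (simp add: add_divide_distrib)
      qed
      have c: "((\<lambda>s. c / ln s) \<longlongrightarrow> 0) at_top" for c :: real by real_asymp
      show "((\<lambda>s. 1 + ln (\<sigma> s) / ln s + ln R0 / ln s) \<longlongrightarrow> 1 + k) at_top"
        using tendsto_add[OF tendsto_add[OF tendsto_const[of 1] \<sigma>_lim] c[of "ln R0"]] by simp
      show "((\<lambda>s. 1 + ln (\<sigma> s) / ln s + ln (1 + R0) / ln s) \<longlongrightarrow> 1 + k) at_top"
        using tendsto_add[OF tendsto_add[OF tendsto_const[of 1] \<sigma>_lim] c[of "ln (1 + R0)"]] by simp
    qed
  qed (use k in auto)
qed

section \<open>Determination of \<open>b\<close> and the exponents for the three demand
  classes\<close>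

theorem mainTheorem2:
  fixes R P \<sigma> r n \<rho> :: "real \<Rightarrow> real" and R0 b d :: real
  assumes R_nonneg: "\<And>y. y \<ge> 1 \<Longrightarrow> R y \<ge> 0"
    and R_integrable: "set_integrable lborel {1..} R"
    and R0_eq: "R0 = (LINT y:{1..}|lborel. R y)"
    and R0_pos: "R0 > 0"
    and r_eq: "\<And>y. y \<ge> 1 \<Longrightarrow> r y = R y / R0"
    and r_bounded: "bounded (r ` {1..})"
    and r_continuous: "continuous_on {1..} r"
    and r_1: "r 1 > 0"
    and P_nonneg: "\<And>s. s \<ge> 1 \<Longrightarrow> P s \<ge> 0"
    and P_continuous: "continuous_on {1..} P"
    and P_nonincreasing: "antimono_on {1..} P"
    and P_vanishes: "eventually (\<lambda>s. P s = 0) at_top"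
    and P_differentiable: "P differentiable (at 1 within {1..})"
    and minimal_income: "1 - P 1 + \<sigma> 1 * R0 = 0"
    and demand: "demand_function \<sigma>"
    and balance: "\<And>s. s > 1 \<Longrightarrow>
          (LINT y:{1<..<s}|lborel. \<sigma> y * R (s / y) * n y) = (s - P s + s * \<sigma> s * R0) * n s"
    and n_form: "\<And>x. 0 < x \<Longrightarrow> x < 1 \<Longrightarrow>
          n (1 / x) = x powr b * (1 - x) powr d * (\<rho> x / \<sigma> (1 / x))"
    and b_gt: "b > 1" and d_gt: "d > -1"
    and rho_continuous: "continuous_on {0..1} \<rho>"
    and rho_pos: "\<And>x. 0 \<le> x \<Longrightarrow> x \<le> 1 \<Longrightarrow> \<rho> x > 0"
    and rho_bounded: "bounded (\<rho> ` {0..1})"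
  shows "(l_demand \<sigma> \<longrightarrow>
            has_pareto_exponent (net_income_distribution n) (gross_income \<sigma> R0) 1 \<and>
            has_pareto_exponent (net_income_distribution n) (\<lambda>s. s) 2) \<and>
         (u_demand \<sigma> \<longrightarrow>
            has_pareto_exponent (net_income_distribution n) (gross_income \<sigma> R0) 1 \<and>
            has_pareto_exponent (net_income_distribution n) (\<lambda>s. s) 1) \<and>
         (\<forall>S0. s_demand \<sigma> S0 \<longrightarrow>
            (\<exists>\<alpha>>0. alpha_equation R R0 S0 \<alpha> \<and>
               (\<forall>\<beta>>0. alpha_equation R R0 S0 \<beta> \<longrightarrow> \<beta> = \<alpha>) \<and>
               has_pareto_exponent (net_income_distribution n) (gross_income \<sigma> R0) (1 + \<alpha>) \<and>
               has_pareto_exponent (net_income_distribution n) (\<lambda>s. s) (1 + \<alpha>)))"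
proof -
  have R_eq: "R y = R0 * r y" if "y \<ge> 1" for y using r_eq[OF that] R0_pos by simp
  have R_cont: "continuous_on {1..} R"
    using continuous_on_mult[OF continuous_on_const[of _ R0] r_continuous]
    by (rule continuous_on_eq) (simp add: R_eq)
  have R1: "R 1 > 0" using R_eq[of 1] R0_pos r_1 by simp
  have \<sigma>_mono: "mono_on {1..} \<sigma>" and \<sigma>_1: "\<sigma> 1 = 1"
    using demand by (auto simp: demand_function_def)
  have \<sigma>_ge: "\<sigma> s \<ge> 1" if "s \<ge> 1" for s
    using mono_onD[OF \<sigma>_mono, of 1 s] that \<sigma>_1 by simp
  have \<sigma>_cont: "continuous_on {1..} \<sigma>"
  proof -
    obtain D where D0: "\<forall>s\<ge>1. D 0 s = \<sigma> s"
      and D1: "\<forall>k. \<forall>s\<ge>1. (D k has_real_derivative D (Suc k) s) (at s within {1..})"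
      using demand unfolding demand_function_def smooth_from_1_def by blast
    have "continuous_on {1..} (D 0)"
      using D1 by (intro DERIV_continuous_on[where D = "D (Suc 0)"]) auto
    then show ?thesis by (rule continuous_on_eq) (use D0 in auto)
  qed
  have n_eq: "n s = s powr (- b) * ((1 - 1 / s) powr d * \<rho> (1 / s)) / \<sigma> s" if "s > 1" for s
    using n_form[of "1 / s"] that by (simp add: powr_divide powr_minus_divide)
  have moment: "set_integrable lborel {1..} (\<lambda>t. t powr (b - 2) * R t)"
      "(LINT t:{1..}|lborel. t powr (b - 2) * R t) = R0 + w"
    if "((\<lambda>s. 1 / \<sigma> s) \<longlongrightarrow> w) at_top" "w \<ge> 0" for w
    by (rule R_moment_identity[where P = P and n = n and \<sigma> = \<sigma> and \<rho> = \<rho> and d = d];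
        fact that R_nonneg R_cont R0_pos \<sigma>_ge P_vanishes balance n_eq d_gt rho_continuous rho_pos)+
  have exponents: "has_pareto_exponent (net_income_distribution n) (\<lambda>s. s) (b - 1 + k)"
      "has_pareto_exponent (net_income_distribution n) (gross_income \<sigma> R0) ((b - 1 + k) / (1 + k))"
    if "((\<lambda>s. ln (\<sigma> s) / ln s) \<longlongrightarrow> k) at_top" "k \<ge> 0" "b \<ge> 2" for k
    by (rule income_pareto_exponents[where \<rho> = \<rho> and d = d];
        fact that R0_pos \<sigma>_cont \<sigma>_mono \<sigma>_ge n_eq d_gt rho_continuous rho_pos)+
  have strict: "(LINT t:{1..}|lborel. t powr p * R t) < (LINT t:{1..}|lborel. t powr q * R t)"
    if "set_integrable lborel {1..} (\<lambda>t. t powr p * R t)"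
      "set_integrable lborel {1..} (\<lambda>t. t powr q * R t)" "p < q" for p q
    by (rule set_integral_powr_strict_mono; fact that R_nonneg R_cont R1)
  have int0: "set_integrable lborel {1..} (\<lambda>t. t powr 0 * R t)"
    and R0_eq0: "(LINT t:{1..}|lborel. t powr 0 * R t) = R0"
  proof -
    \<comment> \<open>Since \<open>0 powr 0 = 0\<close>, the factor \<open>t powr 0\<close> is 1
      only for \<open>t \<noteq> 0\<close>; the indicator makes the integrands agree
      everywhere.\<close>
    have *: "(\<lambda>t. indicator {1..} t *\<^sub>R (t powr 0 * R t)) = (\<lambda>t. indicator {1..} t *\<^sub>R R t)"
      by (auto simp: indicator_def)
    show "set_integrable lborel {1..} (\<lambda>t. t powr 0 * R t)"
      using R_integrable unfolding set_integrable_def * .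
    show "(LINT t:{1..}|lborel. t powr 0 * R t) = R0"
      unfolding R0_eq set_lebesgue_integral_def * ..
  qed
  \<comment> \<open>Here \<open>w = 0\<close>, so the moments of orders \<open>b - 2\<close> and 0
    are both \<open>R0\<close>, and strict monotonicity leaves only
    \<open>b - 2 = 0\<close>.\<close>
  have b_eq_2: "b = 2" if "filterlim \<sigma> at_top at_top"
  proof -
    have "((\<lambda>s. 1 / \<sigma> s) \<longlongrightarrow> 0) at_top"
      by (rule tendsto_divide_0[OF tendsto_const filterlim_at_top_imp_at_infinity[OF that]])
    from moment[OF this] have int: "set_integrable lborel {1..} (\<lambda>t. t powr (b - 2) * R t)"
      and eq: "(LINT t:{1..}|lborel. t powr (b - 2) * R t) = R0" by auto
    show ?thesis
    proof (rule linorder_cases[of "b - 2" 0])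
      assume "b - 2 < 0"
      from strict[OF int int0 this] show ?thesis using eq R0_eq0 by simp
    next
      assume "0 < b - 2"
      from strict[OF int0 int this] show ?thesis using eq R0_eq0 by simp
    qed simp
  qed
  show ?thesis
  proof (intro conjI impI allI)
    assume l: "l_demand \<sigma>"
    then have \<sigma>: "\<sigma> s = s" if "s > 1" for s using that by (simp add: l_demand_def)
    have ev: "eventually (\<lambda>s. s = \<sigma> s) at_top" "eventually (\<lambda>s. 1 = ln (\<sigma> s) / ln s) at_top"
      by (rule eventually_mono[OF eventually_gt_at_top[of 1]]; simp add: \<sigma>)+
    have "filterlim \<sigma> at_top at_top"
      using filterlim_cong[OF refl refl ev(1)] filterlim_ident by blast
    then have b: "b = 2" by (rule b_eq_2)
    \<comment> \<open>With \<open>k = 1\<close> and \<open>b = 2\<close> the net exponent is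
      \<open>2 - 1 + 1 = 2\<close> and the gross exponent \<open>2 / (1 + 1) = 1\<close>.\<close>
    have "((\<lambda>s. ln (\<sigma> s) / ln s) \<longlongrightarrow> 1) at_top"
      using tendsto_const ev(2) by (rule Lim_transform_eventually)
    from exponents[OF this] b
    show "has_pareto_exponent (net_income_distribution n) (gross_income \<sigma> R0) 1"
      "has_pareto_exponent (net_income_distribution n) (\<lambda>s. s) 2" by auto
  next
    assume u: "u_demand \<sigma>"
    then have b: "b = 2" by (intro b_eq_2) (simp add: u_demand_def)
    \<comment> \<open>Slow variation gives \<open>k = 0\<close>, so both exponents equal
      \<open>b - 1 = 1\<close>.\<close>
    have "((\<lambda>s. ln (\<sigma> s) / ln s) \<longlongrightarrow> 0) at_top"
      using u by (intro slowly_varying_ln_ratio \<sigma>_mono \<sigma>_ge) (auto simp: u_demand_def)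
    from exponents[OF this] b
    show "has_pareto_exponent (net_income_distribution n) (gross_income \<sigma> R0) 1"
      "has_pareto_exponent (net_income_distribution n) (\<lambda>s. s) 1" by auto
  next
    fix S0 assume "s_demand \<sigma> S0"
    then have lim: "(\<sigma> \<longlongrightarrow> S0) at_top" by (simp add: s_demand_def)
    have S0: "S0 \<ge> 1"
      using lim by (rule tendsto_lowerbound) (use \<sigma>_ge in \<open>auto intro!: eventually_at_top_linorderI\<close>)
    have "((\<lambda>s. 1 / \<sigma> s) \<longlongrightarrow> 1 / S0) at_top" using lim S0 by (intro tendsto_intros) auto
    from moment[OF this] S0
    have int: "set_integrable lborel {1..} (\<lambda>t. t powr (b - 2) * R t)"
      and eq: "(LINT t:{1..}|lborel. t powr (b - 2) * R t) = R0 + 1 / S0" by auto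
    \<comment> \<open>The moment of order \<open>b - 2\<close> exceeds the zeroth moment
      \<open>R0\<close> by \<open>1 / S0 > 0\<close>; for \<open>b \<le> 2\<close> it would be at
      most \<open>R0\<close>.\<close>
    have b: "b - 2 > 0"
    proof (rule ccontr)
      assume "\<not> b - 2 > 0"
      then consider "b - 2 = 0" | "b - 2 < 0" by linarith
      then show False
      proof cases
        case 1
        then show False using eq R0_eq0 S0 by simp
      next
        case 2
        have "1 / S0 > 0" using S0 by simp
        with strict[OF int int0 2] show False unfolding eq R0_eq0 by linarith
      qed
    qed
    have alpha_iff: "alpha_equation R R0 S0 \<beta> \<longleftrightarrow>
       set_integrable lborel {1..} (\<lambda>t. t powr \<beta> * R t) \<and>
       (LINT t:{1..}|lborel. t powr \<beta> * R t) = R0 + 1 / S0" for \<beta>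
      using R0_pos S0 by (auto simp: alpha_equation_def field_simps)
    \<comment> \<open>Two exponents with the same moment coincide by strict monotonicity, so the
      witness for \<open>\<alpha>\<close> is \<open>b - 2\<close>.\<close>
    have unique: "\<beta> = b - 2" if "alpha_equation R R0 S0 \<beta>" for \<beta>
      using that strict[OF int, of \<beta>] strict[OF _ int, of \<beta>] eq
      unfolding alpha_iff by (cases \<beta> "b - 2" rule: linorder_cases) auto
    \<comment> \<open>The numerator converges to \<open>ln S0\<close>, so again
      \<open>k = 0\<close>, and both exponents are \<open>b - 1 = 1 + (b - 2)\<close>.\<close>
    have "((\<lambda>s. ln (\<sigma> s) / ln s) \<longlongrightarrow> 0) at_top"
      using S0 by (intro tendsto_divide_0[OF tendsto_ln[OF lim]] filterlim_at_top_imp_at_infinity ln_at_top) auto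
    from exponents[OF this] b
    have "has_pareto_exponent (net_income_distribution n) (gross_income \<sigma> R0) (1 + (b - 2))"
      "has_pareto_exponent (net_income_distribution n) (\<lambda>s. s) (1 + (b - 2))" by simp_all
    moreover have "alpha_equation R R0 S0 (b - 2)" unfolding alpha_iff using int eq by blast
    ultimately show "\<exists>\<alpha>>0. alpha_equation R R0 S0 \<alpha> \<and>
               (\<forall>\<beta>>0. alpha_equation R R0 S0 \<beta> \<longrightarrow> \<beta> = \<alpha>) \<and>
               has_pareto_exponent (net_income_distribution n) (gross_income \<sigma> R0) (1 + \<alpha>) \<and>
               has_pareto_exponent (net_income_distribution n) (\<lambda>s. s) (1 + \<alpha>)"
      using b unique by blast
  qed
qed

end
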